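(* Let $\Theta$ be a locally compact Hausdorff space countable at infinity, let $X$ be a Banach space, let $\varphi=\{\varphi_t\}_{t\in\mathbb{R}}$ be a continuous flow on $\Theta$, and let $\Phi=\{\Phi_t(\theta)\}_{t\ge 0,\theta\in\Theta}$ be a strongly continuous exponentially bounded cocycle over $\varphi$ acting on the trivial bundle $\Theta\times X$. Let $\Psi$ be the adjoint cocycle of $\Phi$. Then the following conditions are equivalent: (i) $\Phi$ does not have exponential dichotomy; (ii) there is a Mañé sequence either for the cocycle $\Phi$ or for its adjoint $\Psi$.
   Context: "Countable at infinity" means $\sigma$-compact. $\mathcal{L}(X)$ denotes the bounded linear operators on $X$. Cocycle: a strongly continuous exponentially bounded cocycle $\Phi$ over the flow $\varphi$ acting on $\Theta\times X$ is a family $\{\Phi_t(\theta)\}_{t\ge0,\theta\in\Theta}\subset\mathcal{L}(X)$, strongly continuous in $(t,\theta)$ (i.e. $(t,\theta)\mapsto\Phi_t(\theta)x$ is continuous for each $x\in X$), with $\Phi_0(\theta)=I$, $\Phi_t(\varphi_s(\theta))\Phi_s(\theta)=\Phi_{t+s}(\theta)$ for all $\theta\in\Theta$, $t,s\ge0$, and $\sup_{0\le t\le1,\,\theta\in\Theta}\|\Phi_t(\theta)\|<\infty$. Exponential dichotomy: $\Phi$ has exponential dichotomy if there exist a projector-valued mapping $\theta\mapsto P(\theta)\in\mathcal{L}(X)$, continuous in the strong operator topology, and constants $\varepsilon>0$, $M>0$ such that (1) $\Phi_t(\theta)P(\theta)=P(\varphi_t(\theta))\Phi_t(\theta)$ for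 all $t\ge0$, $\theta\in\Theta$; (2) $\sup_{\theta\in\Theta}\|\Phi_t(\theta)|_{\mathrm{Im}\,P(\theta)}\|\le Me^{-\varepsilon t}$ for all $t\ge0$; (3) the restriction $\Phi_t(\theta)|_{\mathrm{Ker}\,P(\theta)}:\mathrm{Ker}\,P(\theta)\to\mathrm{Ker}\,P(\varphi_t(\theta))$ is invertible, and $\|\Phi_t(\theta)x\|\ge M^{-1}e^{\varepsilon t}\|x\|$ for all $x\in\mathrm{Ker}\,P(\theta)$, $t\ge0$, $\theta\in\Theta$. Adjoint cocycle: $\Psi$ is the cocycle over the inverse flow $\{\varphi_{-t}\}_{t\in\mathbb{R}}$ acting on $\Theta\times X^*$ by $\Psi_t(\theta)=\big(\Phi_t(\varphi_{-t}(\theta))\big)^*$, $t\ge0$. Mañé sequence: a sequence of pairs $\{(\theta_n,x_n)\}_{n=1}^\infty$, $\theta_n\in\Theta$, $x_n\in X$, is a Mañé sequence of $\Phi$ if $\{x_n\}$ is bounded and there are constants $C>0$, $c>0$ such that for all $n\in\mathbb{N}$: $\|\Phi_n(\theta_n)x_n\|>c$ and $\|\Phi_k(\theta_n)x_n\|<C$ for all $0\le k\le 2n$. A Mañé sequence of $\Psi$ is defined in the same way with $\Psi$ in place of $\Phi$ and vectors $x_n^*\in X^*$. *)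

theory Defs
  imports "HOL-Analysis.Analysis"
begin

definition sigma_compact_space :: "'a::topological_space itself \<Rightarrow> bool" where
  "sigma_compact_space _ \<longleftrightarrow>
     (\<exists>K :: nat \<Rightarrow> 'a set. (\<forall>n. compact (K n)) \<and> (\<Union>n. K n) = UNIV)"

definition continuous_flow :: "(real \<Rightarrow> 'a::topological_space \<Rightarrow> 'a) \<Rightarrow> bool" where
  "continuous_flow \<phi> \<longleftrightarrow>
     continuous_on UNIV (\<lambda>(t, \<theta>). \<phi> t \<theta>) \<and>
     (\<forall>\<theta>. \<phi> 0 \<theta> = \<theta>) \<and>
     (\<forall>s t \<theta>. \<phi> (s + t) \<theta> = \<phi> s (\<phi> t \<theta>))"

(* A family indexed by times t >= 0 is a function on all of real; its values at negative
   times are arbitrary and are never referred to. *)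
definition exp_bounded_cocycle ::
  "(real \<Rightarrow> 'a::topological_space \<Rightarrow> 'a) \<Rightarrow>
   (real \<Rightarrow> 'a \<Rightarrow> ('b::real_normed_vector \<Rightarrow>\<^sub>L 'b)) \<Rightarrow> bool" where
  "exp_bounded_cocycle \<phi> \<Phi> \<longleftrightarrow>
     (\<forall>x. continuous_on ({0..} \<times> UNIV) (\<lambda>(t, \<theta>). \<Phi> t \<theta> x)) \<and>
     (\<forall>\<theta>. \<Phi> 0 \<theta> = id_blinfun) \<and>
     (\<forall>\<theta> t s. 0 \<le> t \<longrightarrow> 0 \<le> s \<longrightarrow> \<Phi> t (\<phi> s \<theta>) o\<^sub>L \<Phi> s \<theta> = \<Phi> (t + s) \<theta>) \<and>
     bdd_above ((\<lambda>(t, \<theta>). norm (\<Phi> t \<theta>)) ` ({0..1} \<times> UNIV))"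

definition blinfun_ker :: "('a::real_normed_vector \<Rightarrow>\<^sub>L 'b::real_normed_vector) \<Rightarrow> 'a set" where
  "blinfun_ker A = {x. A x = 0}"

(* The bound on the operator norm of the restriction to Im P(theta), uniform in theta, is
   written out pointwise.  M and e do not depend on t or theta. *)
definition has_exponential_dichotomy ::
  "(real \<Rightarrow> 'a::topological_space \<Rightarrow> 'a) \<Rightarrow>
   (real \<Rightarrow> 'a \<Rightarrow> ('b::real_normed_vector \<Rightarrow>\<^sub>L 'b)) \<Rightarrow> bool" where
  "has_exponential_dichotomy \<phi> \<Phi> \<longleftrightarrow>
     (\<exists>(P :: 'a \<Rightarrow> ('b \<Rightarrow>\<^sub>L 'b)) (\<epsilon>::real) (M::real).
        \<epsilon> > 0 \<and> M > 0 \<and>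
        (\<forall>\<theta>. P \<theta> o\<^sub>L P \<theta> = P \<theta>) \<and>
        (\<forall>x. continuous_on UNIV (\<lambda>\<theta>. P \<theta> x)) \<and>
        (\<forall>t\<ge>0. \<forall>\<theta>. \<Phi> t \<theta> o\<^sub>L P \<theta> = P (\<phi> t \<theta>) o\<^sub>L \<Phi> t \<theta>) \<and>
        (\<forall>t\<ge>0. \<forall>\<theta>. \<forall>x\<in>range (blinfun_apply (P \<theta>)).
            norm (\<Phi> t \<theta> x) \<le> M * exp (- \<epsilon> * t) * norm x) \<and>
        (\<forall>t\<ge>0. \<forall>\<theta>.
            bij_betw (blinfun_apply (\<Phi> t \<theta>)) (blinfun_ker (P \<theta>)) (blinfun_ker (P (\<phi> t \<theta>))) \<and>
            (\<forall>x\<in>blinfun_ker (P \<theta>). norm (\<Phi> t \<theta> x) \<ge> inverse M * exp (\<epsilon> * t) * norm x)))"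

(* The library's adjoint is the one for inner product spaces; here it is the dual operator
   between the norm duals. *)
lift_definition blinfun_adjoint ::
  "('a::real_normed_vector \<Rightarrow>\<^sub>L 'b::real_normed_vector) \<Rightarrow> ('b \<Rightarrow>\<^sub>L real) \<Rightarrow>\<^sub>L ('a \<Rightarrow>\<^sub>L real)"
  is "\<lambda>A f. f o\<^sub>L A"
  by (rule bounded_bilinear.bounded_linear_left[OF bounded_bilinear_blinfun_compose])

definition adjoint_cocycle ::
  "(real \<Rightarrow> 'a \<Rightarrow> 'a) \<Rightarrow> (real \<Rightarrow> 'a \<Rightarrow> ('b::real_normed_vector \<Rightarrow>\<^sub>L 'b)) \<Rightarrow>
   real \<Rightarrow> 'a \<Rightarrow> (('b \<Rightarrow>\<^sub>L real) \<Rightarrow>\<^sub>L ('b \<Rightarrow>\<^sub>L real))" where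
  "adjoint_cocycle \<phi> \<Phi> t \<theta> = blinfun_adjoint (\<Phi> t (\<phi> (- t) \<theta>))"

(* Sequences are indexed by n >= 1; the terms at 0 are irrelevant. *)
definition Mane_sequence ::
  "(real \<Rightarrow> 'a \<Rightarrow> ('b::real_normed_vector \<Rightarrow>\<^sub>L 'b)) \<Rightarrow> (nat \<Rightarrow> 'a \<times> 'b) \<Rightarrow> bool" where
  "Mane_sequence \<Phi> u \<longleftrightarrow>
     bounded ((\<lambda>n. snd (u n)) ` {1..}) \<and>
     (\<exists>C>0. \<exists>c>0. \<forall>n\<ge>1.
        norm (\<Phi> (real n) (fst (u n)) (snd (u n))) > c \<and>
        (\<forall>k\<le>2 * n. norm (\<Phi> (real k) (fst (u n)) (snd (u n))) < C))"

end

theory Submission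
  imports Defs
begin

text \<open>
Without Mane sequences there is an \<open>N\<close> such that along every orbit of the cocycle the norm at the
middle of a time window of length \<open>2 N\<close> is at most half of its maximum over the window; otherwise
suitably scaled counterexamples for all \<open>N\<close> would form a Mane sequence
(\<open>window_contraction_if_no_Mane\<close>).  Iterating this inequality, every bounded forward orbit decays
exponentially and every bounded backward orbit decays exponentially in backward time, with constants
that depend only on \<open>N\<close> and on the bound \<open>K\<close> of the cocycle for times up to one (\<open>stable_decay\<close>,
\<open>unstable_growth\<close>).  The vectors with bounded forward orbits and those with bounded backward orbits
form two families of subspaces, the stable and unstable fibres.  They are invariant, and the angle
between them is bounded from below, because the same operator halves the vectors of one and doubles
those of the other (\<open>uniform_transversality\<close>).

The decisive point is that the two fibres span the whole space, and this is where the adjoint cocycle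
enters (\<open>splitting_exists\<close>).  On the bounded two-sided sequences along a fixed orbit of the flow,
consider the operator that maps \<open>y\<close> to \<open>y (j + 1) - \<Phi> 1 (y j)\<close>.  The window inequality also holds
approximately for pseudo-orbits, so the operator is bounded below and its range is closed.  A
functional that annihilates the range restricts to a bounded two-sided orbit of the adjoint cocycle,
which vanishes by the window inequality for the adjoint.  By the Hahn-Banach theorem the range contains
all sequences with a single nonzero entry.  A preimage of such a sequence consists of a bounded
backward orbit and a bounded forward orbit that are separated by a prescribed jump, and so decomposes
the jump into an unstable and a stable vector.  The projections onto the stable fibres are strongly
continuous as a consequence of the uniform estimates (\<open>strongly_continuous_projection\<close>).

Conversely, a dichotomy splits the vectors of a Mane sequence, with uniform bounds, into a part that
has decayed by time \<open>n\<close> and a part that will still grow exponentially until time \<open>2 n\<close>.  Since the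
orbit is bounded at both ends of the window, it is small in the middle, and the same argument applies
to the adjoint cocycle by duality.
\<close>

section \<open>Separation by bounded functionals\<close>

definition sublinear :: "('v::real_vector \<Rightarrow> real) \<Rightarrow> bool" where
  "sublinear q \<longleftrightarrow> (\<forall>x y. q (x + y) \<le> q x + q y) \<and> (\<forall>t\<ge>0. \<forall>x. q (t *\<^sub>R x) = t * q x)"

lemma sublinear_add: "sublinear q \<Longrightarrow> q (x + y) \<le> q x + q y"
  and sublinear_scale: "sublinear q \<Longrightarrow> 0 \<le> t \<Longrightarrow> q (t *\<^sub>R x) = t * q x"
  by (auto simp: sublinear_def)

lemma sublinear_zero: "sublinear q \<Longrightarrow> q 0 = 0"
  using sublinear_scale[of q 0 0] by simp

lemma sublinear_uminus: "sublinear q \<Longrightarrow> - q (- x) \<le> q x"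
  using sublinear_add[of q x "- x"] sublinear_zero[of q] by simp

lemma sublinearI:
  assumes add: "\<And>x y. q (x + y) \<le> q x + q y"
    and zero: "q 0 = 0"
    and scale: "\<And>t x. 0 < t \<Longrightarrow> q (t *\<^sub>R x) \<le> t * q x"
  shows "sublinear q"
proof -
  have "q (t *\<^sub>R x) = t * q x" if "0 \<le> t" for t x
  proof (cases "t = 0")
    case False
    with that have t: "0 < t" by simp
    have "q x = q (inverse t *\<^sub>R (t *\<^sub>R x))" using t by simp
    also have "\<dots> \<le> inverse t * q (t *\<^sub>R x)" using t by (intro scale) simp
    finally have "t * q x \<le> q (t *\<^sub>R x)" using t by (simp add: field_simps)
    with scale[OF t, of x] show ?thesis by simp
  qed (simp add: zero)
  with add show ?thesis by (simp add: sublinear_def)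
qed

text \<open>The function \<open>q x = inf {p (x + t v) - t p v | t \<ge> 0}\<close> is the largest sublinear functional below
\<open>p\<close> that satisfies \<open>q (- v) \<le> - p v\<close>.  The construction serves two purposes: applied to a minimal
sublinear functional it shows that the functional is odd, and applied to a distance function it
prepares a linear minorant that does not vanish at \<open>v\<close>.\<close>

lemma sublinear_lower_at:
  fixes p :: "'v::real_vector \<Rightarrow> real"
  assumes p: "sublinear p"
  obtains q where "sublinear q" "q \<le> p" "q (- v) \<le> - p v"
proof -
  define h where "h x t = p (x + t *\<^sub>R v) - t * p v" for x t
  define q where "q x = (INF t\<in>{0..}. h x t)" for x
  have lower: "- p (- x) \<le> h x t" if "0 \<le> t" for x t
  proof -
    have "t * p v = p ((x + t *\<^sub>R v) + - x)"
      using sublinear_scale[OF p that] by simp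
    also have "\<dots> \<le> p (x + t *\<^sub>R v) + p (- x)" by (rule sublinear_add[OF p])
    finally show ?thesis by (simp add: h_def)
  qed
  have bdd: "bdd_below (h x ` {0..})" for x
    by (rule bdd_belowI2[of _ "- p (- x)"]) (simp add: lower)
  have q_le: "q x \<le> h x t" if "0 \<le> t" for x t
    unfolding q_def by (rule cINF_lower[OF bdd]) (simp add: that)
  have q_ge: "c \<le> q x" if "\<And>t. 0 \<le> t \<Longrightarrow> c \<le> h x t" for c x
    unfolding q_def by (rule cINF_greatest) (use that in auto)
  have le_p: "q x \<le> p x" for x using q_le[of 0 x] by (simp add: h_def)
  have "sublinear q"
  proof (rule sublinearI)
    fix x y
    have sum: "q (x + y) \<le> h x s + h y t" if "0 \<le> s" "0 \<le> t" for s t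
    proof -
      have "q (x + y) \<le> p (x + y + (s + t) *\<^sub>R v) - (s + t) * p v"
        using q_le[of "s + t" "x + y"] that by (simp add: h_def)
      also have "x + y + (s + t) *\<^sub>R v = (x + s *\<^sub>R v) + (y + t *\<^sub>R v)"
        by (simp add: algebra_simps)
      also have "p \<dots> \<le> p (x + s *\<^sub>R v) + p (y + t *\<^sub>R v)" by (rule sublinear_add[OF p])
      finally show ?thesis by (simp add: h_def algebra_simps)
    qed
    have "q (x + y) - h x s \<le> q y" if "0 \<le> s" for s
      by (rule q_ge) (use sum[OF that] in \<open>simp add: algebra_simps\<close>)
    then have "q (x + y) - q y \<le> q x"
      by (intro q_ge) (simp add: algebra_simps)
    then show "q (x + y) \<le> q x + q y" by simp
  next
    show "q 0 = 0"
      using le_p[of 0] q_ge[of 0 0] sublinear_zero[OF p] lower[of _ 0] by force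
  next
    fix t :: real and x
    assume t: "0 < t"
    have "q (t *\<^sub>R x) / t \<le> q x"
    proof (rule q_ge)
      fix s :: real assume s: "0 \<le> s"
      have "q (t *\<^sub>R x) \<le> h (t *\<^sub>R x) (t * s)" using t s by (intro q_le) simp
      also have "t *\<^sub>R x + (t * s) *\<^sub>R v = t *\<^sub>R (x + s *\<^sub>R v)" by (simp add: algebra_simps)
      then have "h (t *\<^sub>R x) (t * s) = t * h x s"
        using sublinear_scale[OF p, of t "x + s *\<^sub>R v"] t by (simp add: h_def right_diff_distrib)
      finally show "q (t *\<^sub>R x) / t \<le> h x s" using t by (simp add: field_simps)
    qed
    then show "q (t *\<^sub>R x) \<le> t * q x" using t by (simp add: field_simps)
  qed
  moreover have "q (- v) \<le> - p v"
    using q_le[of 1 "- v"] sublinear_zero[OF p] by (simp add: h_def)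
  ultimately show thesis using that le_p by (simp add: le_fun_def)
qed

text \<open>A minimal sublinear functional below \<open>p\<close> exists by Zorn's lemma, since the pointwise infimum of a
chain is again sublinear: \<open>- p (- x)\<close> bounds the chain from below at \<open>x\<close>, and of two members of the
chain the smaller one controls both summands.  By minimality, lowering it at \<open>v\<close> changes nothing, so
it is odd, and an odd sublinear functional is linear.\<close>

lemma linear_minorant:
  fixes p :: "'v::real_vector \<Rightarrow> real"
  assumes p: "sublinear p"
  obtains f where "linear f" "f \<le> p"
proof -
  define A where "A = {q. sublinear q \<and> q \<le> p}"
  have "\<exists>m\<in>A. \<forall>a\<in>A. m \<ge> a \<longrightarrow> a = m"
  proof (rule predicate_Zorn)
    show "partial_order_on A (relation_of (\<ge>) A)"
      by (auto simp: partial_order_on_def preorder_on_def refl_on_def trans_def antisym_def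
          relation_of_def)
  next
    fix C assume "C \<in> Chains (relation_of (\<ge>) A)"
    then have CA: "C \<subseteq> A" and chain: "\<And>a b. a \<in> C \<Longrightarrow> b \<in> C \<Longrightarrow> a \<le> b \<or> b \<le> a"
      by (auto simp: Chains_def relation_of_def)
    show "\<exists>u\<in>A. \<forall>a\<in>C. a \<ge> u"
    proof (cases "C = {}")
      case True
      then show ?thesis using p by (auto simp: A_def)
    next
      case False
      define u where "u x = (INF q\<in>C. q x)" for x
      have sub: "sublinear q" "q x \<le> p x" if "q \<in> C" for q x
        using CA that by (auto simp: A_def le_fun_def)
      have "bdd_below ((\<lambda>q. q x) ` C)" for x
      proof (rule bdd_belowI2)
        fix q assume "q \<in> C"
        with sub(2)[OF this, of "- x"] sub(1)[OF this] sublinear_uminus[of q x] show "- p (- x) \<le> q x" by simp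
      qed
      then have u_le: "u x \<le> q x" if "q \<in> C" for q x
        unfolding u_def by (rule cINF_lower) (rule that)
      have u_ge: "c \<le> u x" if "\<And>q. q \<in> C \<Longrightarrow> c \<le> q x" for c x
        unfolding u_def by (rule cINF_greatest) (use False that in auto)
      have "sublinear u"
      proof (rule sublinearI)
        fix x y
        have sum: "u (x + y) \<le> q x + r y" if q: "q \<in> C" and r: "r \<in> C" for q r
        proof -
          obtain s where s: "s \<in> C" "s \<le> q" "s \<le> r" using chain[OF q r] q r by auto
          have "u (x + y) \<le> s (x + y)" by (rule u_le[OF s(1)])
          also have "\<dots> \<le> s x + s y" by (rule sublinear_add[OF sub(1)[OF s(1)]])
          finally show ?thesis using le_funD[OF s(2), of x] le_funD[OF s(3), of y] by linarith
        qed
        have "u (x + y) - q x \<le> u y" if "q \<in> C" for q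
          by (rule u_ge) (use sum[OF that] in \<open>simp add: algebra_simps\<close>)
        then have "u (x + y) - u y \<le> u x" by (intro u_ge) (simp add: algebra_simps)
        then show "u (x + y) \<le> u x + u y" by simp
      next
        obtain q where "q \<in> C" using False by auto
        then show "u 0 = 0"
          using u_le[of q 0] u_ge[of 0 0] sublinear_zero sub(1) by force
      next
        fix t :: real and x assume t: "0 < t"
        have "u (t *\<^sub>R x) / t \<le> u x"
        proof (rule u_ge)
          fix q assume q: "q \<in> C"
          with u_le[OF q, of "t *\<^sub>R x"] sublinear_scale[OF sub(1)[OF q], of t x] t
          show "u (t *\<^sub>R x) / t \<le> q x" by (simp add: field_simps)
        qed
        then show "u (t *\<^sub>R x) \<le> t * u x" using t by (simp add: field_simps)
      qed
      moreover have "u \<le> p"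
        using False u_le sub(2) by (fastforce simp: le_fun_def intro: order_trans)
      ultimately show ?thesis using u_le by (auto simp: A_def le_fun_def)
    qed
  qed
  then obtain m where m: "sublinear m" "m \<le> p" and min: "\<And>q. sublinear q \<Longrightarrow> q \<le> m \<Longrightarrow> q = m"
    by (force simp: A_def intro: order_trans)
  have odd: "m (- v) = - m v" for v
  proof -
    obtain q where "sublinear q" "q \<le> m" "q (- v) \<le> - m v" by (rule sublinear_lower_at[OF m(1)])
    with min[of q] sublinear_uminus[OF m(1), of v] show ?thesis by simp
  qed
  have "linear m"
  proof (rule linearI)
    fix x y
    have "m x = m ((x + y) + - y)" by simp
    also have "\<dots> \<le> m (x + y) + m (- y)" by (rule sublinear_add[OF m(1)])
    finally show "m (x + y) = m x + m y" using sublinear_add[OF m(1), of x y] odd[of y] by simp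
  next
    fix r x
    show "m (r *\<^sub>R x) = r *\<^sub>R m x"
      using sublinear_scale[OF m(1), of r x] sublinear_scale[OF m(1), of "- r" x] odd[of "r *\<^sub>R x"]
      by (cases "0 \<le> r") auto
  qed
  then show thesis using m(2) by (rule that)
qed

text \<open>The Hahn-Banach theorem in the form needed below.  The distance to \<open>W\<close> is sublinear; lowering it at
\<open>v\<close> before taking a linear minorant \<open>f\<close> forces \<open>f v\<close> to be at least the distance of \<open>v\<close> from \<open>W\<close>,
while \<open>f\<close> is bounded by the distance and hence vanishes on \<open>W\<close>.\<close>

lemma subspace_separation:
  fixes W :: "'v::real_normed_vector set"
  assumes W: "subspace W" "closed W" and v: "v \<notin> W"
  obtains f :: "'v \<Rightarrow>\<^sub>L real" where "\<And>w. w \<in> W \<Longrightarrow> f w = 0" "f v \<noteq> 0"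
proof -
  define p where "p x = infdist x W" for x
  have ne: "W \<noteq> {}" using subspace_0[OF W(1)] by auto
  have near: "\<exists>w\<in>W. norm (x - w) < p x + e" if "0 < e" for x e
  proof -
    have "(INF w\<in>W. dist x w) < p x + e" using that ne by (simp add: p_def infdist_notempty)
    moreover have "bdd_below (dist x ` W)" by (rule bdd_belowI2[of _ 0]) simp
    ultimately show ?thesis using ne by (simp add: cINF_less_iff dist_norm)
  qed
  have p_le: "p x \<le> norm (x - w)" if "w \<in> W" for x w
    using infdist_le[OF that, of x] by (simp add: p_def dist_norm)
  have "sublinear p"
  proof (rule sublinearI)
    fix x y
    show "p (x + y) \<le> p x + p y"
    proof (rule field_le_epsilon)
      fix e :: real assume "0 < e"
      then have e: "0 < e / 2" by simp
      obtain w z where w: "w \<in> W" "norm (x - w) < p x + e / 2" and z: "z \<in> W" "norm (y - z) < p y + e / 2"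
        using near[OF e] by metis
      have "p (x + y) \<le> norm ((x + y) - (w + z))"
        by (intro p_le subspace_add[OF W(1)] w z)
      also have "\<dots> \<le> norm (x - w) + norm (y - z)" by (metis add_diff_add norm_triangle_ineq)
      finally show "p (x + y) \<le> p x + p y + e" using w z by simp
    qed
  next
    show "p 0 = 0" using subspace_0[OF W(1)] by (simp add: p_def)
  next
    fix t :: real and x assume t: "0 < t"
    show "p (t *\<^sub>R x) \<le> t * p x"
    proof (rule field_le_epsilon)
      fix e :: real assume "0 < e"
      then obtain w where w: "w \<in> W" "norm (x - w) < p x + e / t"
        using near[of "e / t" x] t by auto
      have "p (t *\<^sub>R x) \<le> norm (t *\<^sub>R x - t *\<^sub>R w)"
        by (intro p_le subspace_scale[OF W(1)] w)
      also have "\<dots> = t * norm (x - w)" using t by (simp flip: scaleR_diff_right)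
      also have "\<dots> \<le> t * (p x + e / t)" using t w by (intro mult_left_mono) auto
      finally show "p (t *\<^sub>R x) \<le> t * p x + e" using t by (simp add: distrib_left)
    qed
  qed
  then obtain q where q: "sublinear q" "q \<le> p" "q (- v) \<le> - p v" by (rule sublinear_lower_at)
  obtain f where f: "linear f" "f \<le> q" using q(1) by (rule linear_minorant)
  have f_le: "f x \<le> p x" for x using f(2) q(2) by (auto simp: le_fun_def intro: order_trans)
  have abs_f: "\<bar>f x\<bar> \<le> norm x" for x
    using f_le[of x] f_le[of "- x"] p_le[OF subspace_0[OF W(1)], of x]
      p_le[OF subspace_0[OF W(1)], of "- x"] linear_neg[OF f(1), of x] by auto
  then have bl: "bounded_linear f"
    using f(1) by (auto simp: bounded_linear_def bounded_linear_axioms_def intro: exI[of _ 1])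
  have "f w = 0" if "w \<in> W" for w
    using f_le[of w] f_le[of "- w"] that subspace_neg[OF W(1) that] linear_neg[OF f(1), of w]
    by (simp add: p_def)
  moreover have "f v \<noteq> 0"
  proof -
    have "- f v \<le> - p v" using f(2) q(3) linear_neg[OF f(1), of v] by (metis le_fun_def order_trans)
    moreover have "0 < p v" using infdist_pos_not_in_closed[OF W(2) ne v] by (simp add: p_def)
    ultimately show ?thesis by simp
  qed
  ultimately show thesis using that[of "Blinfun f"] by (simp add: bounded_linear_Blinfun_apply bl)
qed

text \<open>An operator that is bounded below on a complete space has closed range, so a vector outside the
range is separated from it by a functional that annihilates the range.\<close>

lemma bounded_below_surjective_criterion:
  fixes D :: "'v::real_normed_vector \<Rightarrow> 'w::real_normed_vector"
  assumes D: "bounded_linear D" and c: "0 < c" and below: "\<And>x. c * norm x \<le> norm (D x)"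
    and complete: "complete (UNIV :: 'v set)"
    and annihilator: "\<And>f :: 'w \<Rightarrow>\<^sub>L real. (\<And>x. f (D x) = 0) \<Longrightarrow> f w = 0"
  shows "w \<in> range D"
proof (rule ccontr)
  assume w: "w \<notin> range D"
  have "closed (range D)"
    using complete_isometric_image[OF c subspace_UNIV D _ complete] below
    by (auto intro: complete_imp_closed)
  moreover have "subspace (range D)"
    by (intro subspace_UNIV linear_subspace_image bounded_linear.linear[OF D])
  ultimately obtain f :: "'w \<Rightarrow>\<^sub>L real" where "\<And>x. x \<in> range D \<Longrightarrow> f x = 0" "f w \<noteq> 0"
    using w subspace_separation by metis
  with annihilator[of f] show False by auto
qed

section \<open>Contraction over windows\<close>

text \<open>The step assumption is self-improving: applied to the supremum \<open>A\<close> of \<open>a\<close> it yields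
\<open>A \<le> max D ((A + D) / 2)\<close>, which is possible only for \<open>A \<le> D\<close>.\<close>

lemma halving_bound:
  fixes a :: "'i \<Rightarrow> real"
  assumes bdd: "\<And>j. a j \<le> B"
    and step: "\<And>c j. (\<And>i. a i \<le> c) \<Longrightarrow> a j \<le> D \<or> a j \<le> (c + D) / 2"
  shows "a j \<le> D"
proof -
  define A where "A = (SUP j. a j)"
  have "bdd_above (range a)" by (rule bdd_aboveI2[of _ _ B]) (rule bdd)
  then have le_A: "a i \<le> A" for i unfolding A_def by (intro cSUP_upper) auto
  have "A \<le> max D ((A + D) / 2)"
    unfolding A_def[symmetric] using step[OF le_A]
    by (subst (1) A_def, intro cSUP_least) (auto simp: le_max_iff_disj)
  then have "A \<le> D" by (auto simp: max_def split: if_splits)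
  with le_A[of j] show ?thesis by simp
qed

text \<open>The a priori bound \<open>B\<close> makes the supremum finite, after which the halving argument replaces it by the
bound \<open>D\<close> on the first \<open>N\<close> terms.  Every further block of \<open>N\<close> indices then gains a factor of two.\<close>

lemma half_line_decay:
  fixes a :: "nat \<Rightarrow> real"
  assumes N: "1 \<le> N" and bdd: "\<And>j. a j \<le> B" and D: "0 \<le> D"
    and initial: "\<And>j. j < N \<Longrightarrow> a j \<le> D"
    and window: "\<And>j c. N \<le> j \<Longrightarrow> (\<And>i. j - N \<le> i \<Longrightarrow> i \<le> j + N \<Longrightarrow> a i \<le> c) \<Longrightarrow> a j \<le> c / 2"
  shows "a j \<le> D / 2 ^ (j div N)"
proof -
  have le_D: "a j \<le> D" for j
  proof (rule halving_bound[OF bdd])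
    fix c j assume "\<And>i. a i \<le> c"
    with initial[of j] window[of j c] D show "a j \<le> D \<or> a j \<le> (c + D) / 2"
      by (cases "j < N") auto
  qed
  have "q * N \<le> j \<Longrightarrow> a j \<le> D / 2 ^ q" for q j
  proof (induction q arbitrary: j)
    case 0
    then show ?case using le_D by simp
  next
    case (Suc q)
    have "a j \<le> (D / 2 ^ q) / 2" by (rule window) (use Suc in auto)
    then show ?case by (simp add: field_simps)
  qed
  then show ?thesis by simp
qed

lemma halving_le_exp:
  assumes N: "1 \<le> (N::nat)"
  shows "1 / 2 ^ (j div N) \<le> 2 * exp (- (ln 2 / real N) * real j)"
proof -
  have "real j / real N \<le> real (j div N) + 1"
  proof -
    have "j < (j div N + 1) * N" using N dividend_less_div_times[of N j] by simp
    then have "real j < real ((j div N + 1) * N)" unfolding of_nat_less_iff .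
    then show ?thesis using N by (simp add: field_simps)
  qed
  then have "ln 2 * (real j / real N) \<le> ln 2 * (real (j div N) + 1)" by (intro mult_left_mono) auto
  then have "exp (- ln 2 * real (j div N)) \<le> exp (ln 2 + - (ln 2 / real N) * real j)"
    by (simp add: algebra_simps)
  also have "\<dots> = 2 * exp (- (ln 2 / real N) * real j)" unfolding exp_add by simp
  also have "exp (- ln 2 * real (j div N)) = 1 / 2 ^ (j div N)"
    by (simp add: exp_minus inverse_eq_divide exp_of_nat2_mult)
  finally show ?thesis .
qed

lemma exp_decay_small:
  fixes M \<epsilon> \<eta> :: real
  assumes "0 < \<epsilon>" "0 < \<eta>"
  obtains n :: nat where "1 \<le> n" "M * exp (- \<epsilon> * real n) < \<eta>"
proof -
  have "(\<lambda>n. M * exp (- \<epsilon>) ^ n) \<longlonglongrightarrow> M * 0"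
    using assms by (intro tendsto_intros LIMSEQ_power_zero) simp
  then have "\<forall>\<^sub>F n in sequentially. M * exp (- \<epsilon>) ^ n < \<eta>"
    using assms by (intro order_tendstoD) auto
  then have "\<forall>\<^sub>F n in sequentially. 1 \<le> n \<and> M * exp (- \<epsilon>) ^ n < \<eta>"
    using eventually_ge_at_top by (rule eventually_conj[rotated])
  then obtain n where "1 \<le> n" "M * exp (- \<epsilon>) ^ n < \<eta>"
    by (metis (mono_tags, lifting) eventually_sequentially order_refl)
  then show thesis using that[of n] by (simp flip: exp_of_nat2_mult)
qed

text \<open>The quantitative form of the absence of Mane sequences, with the maximum over the time window
replaced by an upper bound \<open>B\<close>.\<close>

definition window_contraction ::
  "(real \<Rightarrow> 'a \<Rightarrow> ('b::real_normed_vector \<Rightarrow>\<^sub>L 'b)) \<Rightarrow> nat \<Rightarrow> bool" where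
  "window_contraction \<Phi> N \<longleftrightarrow> 1 \<le> N \<and>
     (\<forall>\<theta> x B. (\<forall>k\<le>2 * N. norm (\<Phi> (real k) \<theta> x) \<le> B) \<longrightarrow> norm (\<Phi> (real N) \<theta> x) \<le> B / 2)"

lemma window_contractionD:
  assumes "window_contraction \<Phi> N" "\<And>k. k \<le> 2 * N \<Longrightarrow> norm (\<Phi> (real k) \<theta> x) \<le> B"
  shows "norm (\<Phi> (real N) \<theta> x) \<le> B / 2"
  using assms by (auto simp: window_contraction_def)

text \<open>If the contraction fails for every \<open>N\<close>, then the failing vectors, scaled so that their orbits are
bounded by one on the window, form a Mane sequence with \<open>C = 2\<close> and \<open>c = 1 / 2\<close>.\<close>

lemma window_contraction_if_no_Mane:
  fixes \<Phi> :: "real \<Rightarrow> 'a \<Rightarrow> ('b::real_normed_vector \<Rightarrow>\<^sub>L 'b)"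
  assumes id: "\<And>\<theta>. \<Phi> 0 \<theta> = id_blinfun" and no: "\<nexists>u. Mane_sequence \<Phi> u"
  shows "\<exists>N. window_contraction \<Phi> N"
proof (rule ccontr)
  assume "\<nexists>N. window_contraction \<Phi> N"
  then have ex: "\<exists>\<theta> x. (\<forall>k\<le>2 * n. norm (\<Phi> (real k) \<theta> x) \<le> 1) \<and> 1 / 2 < norm (\<Phi> (real n) \<theta> x)"
    if "1 \<le> n" for n
  proof -
    from that \<open>\<nexists>N. window_contraction \<Phi> N\<close> obtain \<theta> x B
      where le: "\<And>k. k \<le> 2 * n \<Longrightarrow> norm (\<Phi> (real k) \<theta> x) \<le> B"
        and gt: "B / 2 < norm (\<Phi> (real n) \<theta> x)"
      unfolding window_contraction_def by (meson not_le)
    \<comment> \<open>For \<open>B = 0\<close> the orbit would vanish on the window, contrary to \<open>gt\<close>.\<close>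
    have "0 < B" using le[of n] gt norm_ge_zero[of "\<Phi> (real n) \<theta> x"] by linarith
    with le gt have "(\<forall>k\<le>2 * n. norm (\<Phi> (real k) \<theta> (x /\<^sub>R B)) \<le> 1) \<and>
        1 / 2 < norm (\<Phi> (real n) \<theta> (x /\<^sub>R B))"
      by (auto simp: blinfun.scaleR_right field_simps)
    then show ?thesis by blast
  qed
  then obtain \<theta> x where *: "\<And>n. 1 \<le> n \<Longrightarrow> (\<forall>k\<le>2 * n. norm (\<Phi> (real k) (\<theta> n) (x n)) \<le> 1) \<and>
      1 / 2 < norm (\<Phi> (real n) (\<theta> n) (x n))"
    by metis
  have "norm (x n) \<le> 1" if "1 \<le> n" for n
    using *[OF that] by (auto dest!: spec[of _ 0] simp: id)
  then have "bounded (x ` {1..})" by (auto intro: boundedI)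
  moreover have "1 / 2 < norm (\<Phi> (real n) (\<theta> n) (x n)) \<and>
      (\<forall>k\<le>2 * n. norm (\<Phi> (real k) (\<theta> n) (x n)) < 2)" if "1 \<le> n" for n
    using *[OF that] by fastforce
  ultimately have "Mane_sequence \<Phi> (\<lambda>n. (\<theta> n, x n))"
    unfolding Mane_sequence_def by (intro conjI exI[of _ "2::real"] exI[of _ "1/2::real"]) auto
  with no show False by blast
qed

section \<open>Transversal splittings\<close>

text \<open>If \<open>s\<close> were large compared to \<open>s + u\<close>, then \<open>u\<close> would nearly equal \<open>- s\<close>, and \<open>A\<close> could not expand
the one and contract the other.\<close>

lemma expanding_contracting_transversal:
  fixes A :: "'b::real_normed_vector \<Rightarrow>\<^sub>L 'b"
  assumes s: "norm (A s) \<le> norm s / 2" and u: "2 * norm u \<le> norm (A u)"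
  shows "norm s \<le> (norm A + 2) * norm (s + u)"
proof -
  have "norm (A u) \<le> norm (A (s + u)) + norm (A s)"
    using norm_triangle_ineq4[of "A (s + u)" "A s"] by (simp add: blinfun.add_right)
  then have "2 * norm u \<le> norm A * norm (s + u) + norm s / 2"
    using norm_blinfun[of A "s + u"] s u by linarith
  moreover have "norm s \<le> norm (s + u) + norm u"
    using norm_triangle_ineq4[of "s + u" u] by simp
  moreover have "0 \<le> norm s" by simp
  ultimately show ?thesis unfolding distrib_right by linarith
qed

text \<open>The transversality estimate gives uniqueness of the decomposition \<open>x = s + u\<close> as well as boundedness
of the projection along \<open>U\<close>.\<close>

lemma projection_of_splitting:
  fixes S U :: "'b::real_normed_vector set"
  assumes S: "subspace S" and U: "subspace U"
    and sum: "\<And>x. \<exists>s\<in>S. \<exists>u\<in>U. x = s + u"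
    and transversal: "\<And>s u. s \<in> S \<Longrightarrow> u \<in> U \<Longrightarrow> norm s \<le> C * norm (s + u)"
  shows "\<exists>P :: 'b \<Rightarrow>\<^sub>L 'b. (\<forall>s\<in>S. \<forall>u\<in>U. blinfun_apply P (s + u) = s) \<and>
    range (blinfun_apply P) = S \<and> blinfun_ker P = U"
proof -
  obtain p where p: "\<And>x. p x \<in> S \<and> x - p x \<in> U"
    using sum by (metis add_diff_cancel_left')
  have p_eq: "p (s + u) = s" if "s \<in> S" "u \<in> U" for s u
  proof -
    have "p (s + u) - s \<in> S" "(s + u - p (s + u)) - u \<in> U"
      using p that by (simp_all only: subspace_diff[OF S] subspace_diff[OF U])
    then have "norm (p (s + u) - s) \<le> C * norm ((p (s + u) - s) + ((s + u - p (s + u)) - u))"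
      by (rule transversal)
    then show ?thesis by simp
  qed
  have "bounded_linear p"
  proof (rule bounded_linear_intro)
    fix x y r
    show "p (x + y) = p x + p y"
      using p_eq[of "p x + p y" "(x - p x) + (y - p y)"] p[of x] p[of y]
      by (simp add: subspace_add S U)
    show "p (r *\<^sub>R x) = r *\<^sub>R p x"
      using p_eq[of "r *\<^sub>R p x" "r *\<^sub>R (x - p x)"] p[of x]
      by (simp add: subspace_scale S U flip: scaleR_add_right)
    show "norm (p x) \<le> norm x * C"
      using transversal[of "p x" "x - p x"] p[of x] by (simp add: mult.commute)
  qed
  then have app: "blinfun_apply (Blinfun p) = p" by (rule bounded_linear_Blinfun_apply)
  have fixed: "p s = s" if "s \<in> S" for s using p_eq[OF that subspace_0[OF U]] by simp
  have "range p = S" using p fixed by (metis image_subsetI rangeI subset_antisym subsetI)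
  moreover have "{x. p x = 0} = U"
    using p_eq[OF subspace_0[OF S]] p by (auto simp: set_eq_iff) (metis diff_zero)
  ultimately show ?thesis using p_eq by (intro exI[of _ "Blinfun p"]) (simp add: app blinfun_ker_def)
qed

section \<open>The difference operator on bounded sequences\<close>

text \<open>Completeness for an arbitrary topological domain; it is used for \<open>int\<close> with its discrete topology,
where the bounded continuous functions are all bounded two-sided sequences.\<close>

lemma complete_UNIV_bcontfun: "complete (UNIV :: ('a::topological_space \<Rightarrow>\<^sub>C 'b::complete_space) set)"
proof (rule completeI)
  fix f :: "nat \<Rightarrow> 'a \<Rightarrow>\<^sub>C 'b"
  assume "Cauchy f"
  then have "uniformly_Cauchy_on UNIV (\<lambda>n. apply_bcontfun (f n))"
    unfolding Cauchy_def uniformly_Cauchy_on_def by (metis dist_fun_lt_imp_dist_val_lt)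
  then obtain g where "uniform_limit UNIV (\<lambda>n. apply_bcontfun (f n)) g sequentially"
    using Cauchy_uniformly_convergent uniformly_convergent_on_def by blast
  then show "\<exists>l\<in>UNIV. f \<longlonglongrightarrow> l"
    by (rule uniform_limit_bcontfunE) (use trivial_limit_sequentially in auto)
qed

definition single_bcontfun :: "int \<Rightarrow> 'b::real_normed_vector \<Rightarrow> (int \<Rightarrow>\<^sub>C 'b)" where
  "single_bcontfun j x = Bcontfun (\<lambda>i. if i = j then x else 0)"

lemma Bcontfun_int_apply:
  fixes f :: "int \<Rightarrow> 'b::real_normed_vector"
  assumes "\<And>i. norm (f i) \<le> B"
  shows "apply_bcontfun (Bcontfun f) = f"
  by (rule Bcontfun_inverse, rule bcontfun_normI[of _ B]) (use assms in auto)

lemma single_bcontfun_apply: "apply_bcontfun (single_bcontfun j x) i = (if i = j then x else 0)"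
  unfolding single_bcontfun_def by (subst Bcontfun_int_apply[of _ "norm x"]) auto

lemma bounded_linear_single_bcontfun:
  "bounded_linear (single_bcontfun j :: 'b::real_normed_vector \<Rightarrow> _)"
proof (rule bounded_linear_intro)
  show "norm (single_bcontfun j x) \<le> norm x * 1" for x :: 'b
    by (rule norm_bound) (simp add: single_bcontfun_apply)
qed (auto intro!: bcontfun_eqI simp: single_bcontfun_apply)

lemma difference_operator:
  fixes T :: "int \<Rightarrow> ('b::real_normed_vector \<Rightarrow>\<^sub>L 'b)"
  assumes T: "\<And>j. norm (T j) \<le> K"
  obtains D :: "(int \<Rightarrow>\<^sub>C 'b) \<Rightarrow> (int \<Rightarrow>\<^sub>C 'b)"
  where "bounded_linear D" "\<And>x j. D x j = x (j + 1) - T j (x j)"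
proof -
  define D where "D x = Bcontfun (\<lambda>j. x (j + 1) - T j (x j))" for x :: "int \<Rightarrow>\<^sub>C 'b"
  have le: "norm (x (j + 1) - T j (x j)) \<le> norm x * (1 + K)" for x :: "int \<Rightarrow>\<^sub>C 'b" and j
  proof -
    have "norm (T j (x j)) \<le> K * norm x"
      by (rule order_trans[OF norm_blinfun]) (intro mult_mono T norm_bounded order_trans[OF norm_ge_zero T], simp)
    with norm_bounded[of x "j + 1"] norm_triangle_ineq4[of "x (j + 1)" "T j (x j)"]
    show ?thesis by (simp add: algebra_simps)
  qed
  have app: "apply_bcontfun (D x) = (\<lambda>j. x (j + 1) - T j (x j))" for x
    unfolding D_def by (rule Bcontfun_int_apply) (rule le)
  have "bounded_linear D"
  proof (rule bounded_linear_intro)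
    show "norm (D x) \<le> norm x * (1 + K)" for x
      by (rule norm_bound) (simp only: app le)
  qed (auto intro!: bcontfun_eqI simp: app blinfun.add_right blinfun.scaleR_right scaleR_diff_right)
  then show thesis using that[of D] app by simp
qed

text \<open>The condition on pseudo-orbits says that the difference operator is bounded below.  A functional that
annihilates its range restricts to the single entries as a bounded orbit \<open>g\<close> of the dual recursion,
hence vanishes on every sequence with a single nonzero entry, and such a sequence lies in the range.\<close>

lemma bounded_solution_exists:
  fixes T :: "int \<Rightarrow> ('b::banach \<Rightarrow>\<^sub>L 'b)"
  assumes T: "\<And>j. norm (T j) \<le> K" and c: "0 < c"
    and below: "\<And>y B G j. (\<And>j. norm (y j) \<le> B) \<Longrightarrow> (\<And>j. norm (y (j + 1) - T j (y j)) \<le> G) \<Longrightarrow>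
      norm (y j) \<le> c * G"
    and dual: "\<And>(g :: int \<Rightarrow> ('b \<Rightarrow>\<^sub>L real)) B j. (\<And>j. norm (g j) \<le> B) \<Longrightarrow>
      (\<And>j. g j = g (j + 1) o\<^sub>L T (j + 1)) \<Longrightarrow> g j = 0"
  shows "\<exists>y. (\<exists>B. \<forall>j. norm (y j) \<le> B) \<and> (\<forall>j. y (j + 1) - T j (y j) = (if j = - 1 then v else 0))"
proof -
  obtain D :: "(int \<Rightarrow>\<^sub>C 'b) \<Rightarrow> (int \<Rightarrow>\<^sub>C 'b)" where D: "bounded_linear D"
    and D_app: "\<And>x j. D x j = x (j + 1) - T j (x j)"
    using difference_operator[of T K] T by blast
  have "single_bcontfun (- 1) v \<in> range D"
  proof (rule bounded_below_surjective_criterion[OF D])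
    show "0 < inverse c" using c by simp
    show "complete (UNIV :: (int \<Rightarrow>\<^sub>C 'b) set)" by (rule complete_UNIV_bcontfun)
    fix x :: "int \<Rightarrow>\<^sub>C 'b"
    have "norm x \<le> c * norm (D x)"
      by (rule norm_bound, rule below, rule norm_bounded) (simp add: norm_bounded flip: D_app)
    then show "inverse c * norm x \<le> norm (D x)" using c by (simp add: field_simps)
  next
    fix f :: "(int \<Rightarrow>\<^sub>C 'b) \<Rightarrow>\<^sub>L real"
    assume f: "\<And>x. f (D x) = 0"
    define g where "g j = f o\<^sub>L Blinfun (single_bcontfun j)" for j
    have g_app: "g j x = f (single_bcontfun j x)" for j x
      by (simp add: g_def bounded_linear_Blinfun_apply[OF bounded_linear_single_bcontfun])
    have "g (- 1) = 0"
    proof (rule dual)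
      show "norm (g j) \<le> norm f" for j
      proof (rule norm_blinfun_bound)
        fix x :: 'b
        have "norm (single_bcontfun j x) \<le> norm x"
          by (rule norm_bound) (simp add: single_bcontfun_apply)
        then show "norm (g j x) \<le> norm f * norm x"
          unfolding g_app by (rule order_trans[OF norm_blinfun mult_left_mono]) simp
      qed simp
      show "g j = g (j + 1) o\<^sub>L T (j + 1)" for j
      proof (rule blinfun_eqI)
        fix x :: 'b
        have "D (single_bcontfun (j + 1) x) = single_bcontfun j x - single_bcontfun (j + 1) (T (j + 1) x)"
          by (rule bcontfun_eqI) (auto simp: D_app single_bcontfun_apply)
        with f[of "single_bcontfun (j + 1) x"]
        show "g j x = (g (j + 1) o\<^sub>L T (j + 1)) x" by (simp add: g_app blinfun.diff_right)
      qed
    qed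
    then show "f (single_bcontfun (- 1) v) = 0" using g_app[of "- 1" v] by simp
  qed
  then obtain x where "D x = single_bcontfun (- 1) v" by auto
  then have "x (j + 1) - T j (x j) = (if j = - 1 then v else 0)" for j
    by (metis D_app single_bcontfun_apply)
  then show ?thesis using norm_bounded by blast
qed

section \<open>Stable and unstable fibres of a cocycle\<close>

locale flow_cocycle =
  fixes \<phi> :: "real \<Rightarrow> 'a::topological_space \<Rightarrow> 'a"
    and \<Phi> :: "real \<Rightarrow> 'a \<Rightarrow> ('b::banach \<Rightarrow>\<^sub>L 'b)"
    and K :: real
  assumes flow: "continuous_flow \<phi>"
    and cocycle: "exp_bounded_cocycle \<phi> \<Phi>"
    and K_ge_1: "1 \<le> K"
    and norm_le_K: "0 \<le> t \<Longrightarrow> t \<le> 1 \<Longrightarrow> norm (\<Phi> t \<theta>) \<le> K"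
begin

lemma flow_zero [simp]: "\<phi> 0 \<theta> = \<theta>"
  and flow_flow [simp]: "\<phi> s (\<phi> t \<theta>) = \<phi> (s + t) \<theta>"
  using flow by (auto simp: continuous_flow_def)

lemma cocycle_zero [simp]: "\<Phi> 0 \<theta> x = x"
  using cocycle by (simp add: exp_bounded_cocycle_def)

lemma cocycle_compose: "0 \<le> t \<Longrightarrow> 0 \<le> s \<Longrightarrow> \<Phi> t (\<phi> s \<theta>) o\<^sub>L \<Phi> s \<theta> = \<Phi> (t + s) \<theta>"
  using cocycle by (simp add: exp_bounded_cocycle_def)

lemma cocycle_add: "0 \<le> t \<Longrightarrow> 0 \<le> s \<Longrightarrow> \<Phi> t (\<phi> s \<theta>) (\<Phi> s \<theta> x) = \<Phi> (t + s) \<theta> x"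
  by (metis blinfun_compose.rep_eq cocycle_compose comp_apply)

lemma norm_cocycle_le: "0 \<le> t \<Longrightarrow> t \<le> real n \<Longrightarrow> norm (\<Phi> t \<theta>) \<le> K ^ n"
proof (induction n arbitrary: t)
  case 0
  then have "\<Phi> t \<theta> = id_blinfun" by (auto intro: blinfun_eqI)
  then show ?case by (auto intro: norm_blinfun_bound)
next
  case (Suc n)
  show ?case
  proof (cases "t \<le> 1")
    case True
    then have "norm (\<Phi> t \<theta>) \<le> K" using Suc.prems by (intro norm_le_K)
    also have "K \<le> K ^ Suc n" using K_ge_1 by (intro self_le_power) auto
    finally show ?thesis .
  next
    case False
    have "\<Phi> t \<theta> = \<Phi> 1 (\<phi> (t - 1) \<theta>) o\<^sub>L \<Phi> (t - 1) \<theta>"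
      using False by (simp add: cocycle_compose)
    also have "norm \<dots> \<le> norm (\<Phi> 1 (\<phi> (t - 1) \<theta>)) * norm (\<Phi> (t - 1) \<theta>)"
      by (rule norm_blinfun_compose)
    also have "\<dots> \<le> K * K ^ n"
      using Suc False K_ge_1 by (intro mult_mono norm_le_K) auto
    finally show ?thesis by simp
  qed
qed

lemma norm_cocycle_apply_le:
  "0 \<le> t \<Longrightarrow> t \<le> real n \<Longrightarrow> norm (\<Phi> t \<theta> x) \<le> K ^ n * norm x"
  using norm_blinfun[of "\<Phi> t \<theta>" x] mult_right_mono[OF norm_cocycle_le norm_ge_zero] order_trans by blast

lemma norm_cocycle_apply_bound:
  assumes "0 \<le> t" "t \<le> real n" "norm x \<le> B"
  shows "norm (\<Phi> t \<theta> x) \<le> K ^ n * B"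
  using norm_cocycle_apply_le[OF assms(1,2), of \<theta> x] mult_left_mono[OF assms(3), of "K ^ n"] K_ge_1
  by (meson order_trans zero_le_power zero_le_one)

lemma one_le_K_power: "1 \<le> K ^ n"
  using K_ge_1 by (rule one_le_power)

definition stable_fibre :: "'a \<Rightarrow> 'b set" where
  "stable_fibre \<theta> = {x. \<exists>B. \<forall>n::nat. norm (\<Phi> (real n) \<theta> x) \<le> B}"

text \<open>Indices count time backward: \<open>y j\<close> lies in the fibre over \<open>\<phi> (- j) \<theta>\<close>.\<close>

definition backward_orbit :: "'a \<Rightarrow> (nat \<Rightarrow> 'b) \<Rightarrow> bool" where
  "backward_orbit \<theta> y \<longleftrightarrow> (\<exists>B. \<forall>j. norm (y j) \<le> B) \<and>
     (\<forall>i j. \<Phi> (real i) (\<phi> (- real (i + j)) \<theta>) (y (i + j)) = y j)"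

definition unstable_fibre :: "'a \<Rightarrow> 'b set" where
  "unstable_fibre \<theta> = {x. \<exists>y. backward_orbit \<theta> y \<and> y 0 = x}"

lemma backward_orbit_step:
  "backward_orbit \<theta> y \<Longrightarrow> \<Phi> (real i) (\<phi> (- real (i + j)) \<theta>) (y (i + j)) = y j"
  by (simp add: backward_orbit_def)

lemma subspace_stable: "subspace (stable_fibre \<theta>)"
proof (rule subspaceI)
  show "0 \<in> stable_fibre \<theta>" by (auto simp: stable_fibre_def)
next
  fix x y assume "x \<in> stable_fibre \<theta>" "y \<in> stable_fibre \<theta>"
  then obtain B C where "\<And>n. norm (\<Phi> (real n) \<theta> x) \<le> B" "\<And>n. norm (\<Phi> (real n) \<theta> y) \<le> C"
    by (auto simp: stable_fibre_def)
  then have "norm (\<Phi> (real n) \<theta> (x + y)) \<le> B + C" for n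
    by (simp add: blinfun.add_right norm_triangle_mono)
  then show "x + y \<in> stable_fibre \<theta>" by (auto simp: stable_fibre_def)
next
  fix c x assume "x \<in> stable_fibre \<theta>"
  then obtain B where "\<And>n. norm (\<Phi> (real n) \<theta> x) \<le> B" by (auto simp: stable_fibre_def)
  then have "norm (\<Phi> (real n) \<theta> (c *\<^sub>R x)) \<le> \<bar>c\<bar> * B" for n
    by (simp add: blinfun.scaleR_right mult_left_mono)
  then show "c *\<^sub>R x \<in> stable_fibre \<theta>" by (auto simp: stable_fibre_def)
qed

lemma subspace_unstable: "subspace (unstable_fibre \<theta>)"
proof (rule subspaceI)
  have "backward_orbit \<theta> (\<lambda>j. 0)" by (auto simp: backward_orbit_def)
  then show "0 \<in> unstable_fibre \<theta>" by (auto simp: unstable_fibre_def)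
next
  fix x y assume "x \<in> unstable_fibre \<theta>" "y \<in> unstable_fibre \<theta>"
  then obtain v w where v: "backward_orbit \<theta> v" "v 0 = x" and w: "backward_orbit \<theta> w" "w 0 = y"
    by (auto simp: unstable_fibre_def)
  obtain B C where "\<And>j. norm (v j) \<le> B" "\<And>j. norm (w j) \<le> C"
    using v(1) w(1) by (auto simp: backward_orbit_def)
  then have "\<exists>B. \<forall>j. norm (v j + w j) \<le> B" by (meson norm_triangle_mono)
  then have "backward_orbit \<theta> (\<lambda>j. v j + w j)"
    using v(1) w(1) by (simp add: backward_orbit_def blinfun.add_right)
  then show "x + y \<in> unstable_fibre \<theta>" using v w by (auto simp: unstable_fibre_def)
next
  fix c x assume "x \<in> unstable_fibre \<theta>"
  then obtain v where v: "backward_orbit \<theta> v" "v 0 = x" by (auto simp: unstable_fibre_def)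
  obtain B where "\<And>j. norm (v j) \<le> B" using v(1) by (auto simp: backward_orbit_def)
  then have "norm (c *\<^sub>R v j) \<le> \<bar>c\<bar> * B" for j by (simp add: mult_left_mono)
  then have "backward_orbit \<theta> (\<lambda>j. c *\<^sub>R v j)"
    using v(1) by (auto simp: backward_orbit_def blinfun.scaleR_right)
  then show "c *\<^sub>R x \<in> unstable_fibre \<theta>" using v by (auto simp: unstable_fibre_def)
qed

lemma cocycle_swap:
  "0 \<le> s \<Longrightarrow> 0 \<le> t \<Longrightarrow> \<Phi> s (\<phi> t \<theta>) (\<Phi> t \<theta> x) = \<Phi> t (\<phi> s \<theta>) (\<Phi> s \<theta> x)"
  by (simp add: cocycle_add add.commute)

lemma stable_invariant:
  assumes t: "0 \<le> t" and x: "x \<in> stable_fibre \<theta>"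
  shows "\<Phi> t \<theta> x \<in> stable_fibre (\<phi> t \<theta>)"
proof -
  obtain B where B: "\<And>n. norm (\<Phi> (real n) \<theta> x) \<le> B" using x by (auto simp: stable_fibre_def)
  define m where "m = nat \<lceil>t\<rceil>"
  have m: "t \<le> real m" by (simp add: m_def real_nat_ceiling_ge)
  have "norm (\<Phi> (real n) (\<phi> t \<theta>) (\<Phi> t \<theta> x)) \<le> K ^ m * B" for n
    using norm_cocycle_apply_bound[OF t m B[of n], of "\<phi> (real n) \<theta>"] t
    by (simp add: cocycle_swap[of "real n" t])
  then show ?thesis by (auto simp: stable_fibre_def)
qed

lemma unstable_invariant:
  assumes t: "0 \<le> t" and x: "x \<in> unstable_fibre \<theta>"
  shows "\<Phi> t \<theta> x \<in> unstable_fibre (\<phi> t \<theta>)"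
proof -
  obtain y where y: "backward_orbit \<theta> y" "y 0 = x" using x by (auto simp: unstable_fibre_def)
  obtain B where B: "\<And>j. norm (y j) \<le> B" using y(1) by (auto simp: backward_orbit_def)
  define m where "m = nat \<lceil>t\<rceil>"
  have m: "t \<le> real m" by (simp add: m_def real_nat_ceiling_ge)
  define z where "z j = \<Phi> t (\<phi> (- real j) \<theta>) (y j)" for j
  have "norm (z j) \<le> K ^ m * B" for j
    unfolding z_def by (rule norm_cocycle_apply_bound[OF t m B])
  moreover have "\<Phi> (real i) (\<phi> (- real (i + j)) (\<phi> t \<theta>)) (z (i + j)) = z j" for i j
    using cocycle_swap[of "real i" t "\<phi> (- real (i + j)) \<theta>" "y (i + j)"]
      backward_orbit_step[OF y(1), of i j] t
    by (simp add: z_def add.commute)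
  ultimately have "backward_orbit (\<phi> t \<theta>) z" by (auto simp: backward_orbit_def)
  moreover have "z 0 = \<Phi> t \<theta> x" using y(2) by (simp add: z_def)
  ultimately show ?thesis by (auto simp: unstable_fibre_def)
qed

lemma backward_orbit_in_unstable:
  assumes y: "backward_orbit \<theta> y"
  shows "y j \<in> unstable_fibre (\<phi> (- real j) \<theta>)"
proof -
  have "backward_orbit (\<phi> (- real j) \<theta>) (\<lambda>k. y (k + j))"
    unfolding backward_orbit_def
  proof (intro conjI allI)
    show "\<exists>B. \<forall>k. norm (y (k + j)) \<le> B" using y by (auto simp: backward_orbit_def)
    show "\<Phi> (real i) (\<phi> (- real (i + k)) (\<phi> (- real j) \<theta>)) (y (i + k + j)) = y (k + j)" for i k
      using backward_orbit_step[OF y, of i "k + j"] by (simp add: algebra_simps)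
  qed
  then show ?thesis by (auto simp: unstable_fibre_def)
qed

text \<open>For a preimage under a real time \<open>t\<close>, go back along the orbit to the integer time \<open>m \<ge> t\<close> and return
by \<open>m - t\<close>.\<close>

lemma unstable_onto:
  assumes t: "0 \<le> t" and z: "z \<in> unstable_fibre (\<phi> t \<theta>)"
  shows "z \<in> \<Phi> t \<theta> ` unstable_fibre \<theta>"
proof -
  obtain y where y: "backward_orbit (\<phi> t \<theta>) y" "y 0 = z" using z by (auto simp: unstable_fibre_def)
  define m where "m = nat \<lceil>t\<rceil>"
  have m: "0 \<le> real m - t" using t by (simp add: m_def real_nat_ceiling_ge)
  define w where "w = \<Phi> (real m - t) (\<phi> (- (real m - t)) \<theta>) (y m)"
  have "w \<in> unstable_fibre \<theta>"
    using unstable_invariant[OF m backward_orbit_in_unstable[OF y(1), of m]] by (simp add: w_def)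
  moreover have "\<Phi> t \<theta> w = z"
    using cocycle_add[OF t m, of "\<phi> (- (real m - t)) \<theta>" "y m"] backward_orbit_step[OF y(1), of m 0] y(2)
    by (simp add: w_def)
  ultimately show ?thesis by force
qed

text \<open>A bounded backward orbit of \<open>x\<close> is prolonged by a piece of its forward orbit, which makes \<open>x\<close> the
\<open>n\<close>-th element of a bounded backward orbit of its image.  In this way a decay estimate for backward
orbits becomes a growth estimate for the cocycle.\<close>

lemma unstable_extend:
  assumes x: "x \<in> unstable_fibre \<theta>"
  obtains y where "backward_orbit (\<phi> (real n) \<theta>) y" "y n = x" "y 0 = \<Phi> (real n) \<theta> x"
proof -
  obtain v where v: "backward_orbit \<theta> v" "v 0 = x" using x by (auto simp: unstable_fibre_def)
  define y where "y j = (if n \<le> j then v (j - n) else \<Phi> (real (n - j)) \<theta> x)" for j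
  obtain B where B: "\<And>j. norm (v j) \<le> B" using v(1) by (auto simp: backward_orbit_def)
  have "norm (y j) \<le> max B (K ^ n * norm x)" for j
    using B[of "j - n"] norm_cocycle_apply_le[of "real (n - j)" n \<theta> x] by (auto simp: y_def)
  moreover have "\<Phi> (real i) (\<phi> (- real (i + j)) (\<phi> (real n) \<theta>)) (y (i + j)) = y j" for i j
  proof -
    consider "n \<le> j" | "j < n" "n \<le> i + j" | "i + j < n" by linarith
    then show ?thesis
    proof cases
      case 1
      have "i + j - n = i + (j - n)" "real (j - n) = real j - real n" using 1 by auto
      then show ?thesis using backward_orbit_step[OF v(1), of i "j - n"] 1
        by (simp add: y_def algebra_simps)
    next
      case 2
      define k where "k = i + j - n"
      have k: "real i = real (n - j) + real k" "real (i + j) = real n + real k"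
        using 2 by (auto simp: k_def)
      have "\<Phi> (real i) (\<phi> (- real k) \<theta>) (v k) = \<Phi> (real (n - j)) \<theta> (\<Phi> (real k) (\<phi> (- real k) \<theta>) (v k))"
        unfolding k(1) using cocycle_add[of "real (n - j)" "real k" "\<phi> (- real k) \<theta>" "v k"] by simp
      also have "\<Phi> (real k) (\<phi> (- real k) \<theta>) (v k) = x"
        using backward_orbit_step[OF v(1), of k 0] v(2) by simp
      also have "v k = y (i + j)" using 2 by (simp add: y_def k_def)
      also have "\<Phi> (real (n - j)) \<theta> x = y j" using 2 by (simp add: y_def)
      also have "\<phi> (- real k) \<theta> = \<phi> (- real (i + j)) (\<phi> (real n) \<theta>)" 
        using k(2) by (simp del: of_nat_add)
      finally show ?thesis .
    next
      case 3
      then have "real (n - j) = real i + real (n - (i + j))" "- real (i + j) + real n = real (n - (i + j))" by auto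
      then show ?thesis
        using 3 cocycle_add[of "real i" "real (n - (i + j))" \<theta> x]
        by (simp add: y_def del: of_nat_diff of_nat_add)
    qed
  qed
  ultimately have "backward_orbit (\<phi> (real n) \<theta>) y" by (auto simp: backward_orbit_def)
  then show thesis using that v(2) by (auto simp: y_def)
qed

context
  fixes N assumes window: "window_contraction \<Phi> N"
begin

lemma N_ge_1: "1 \<le> N" using window by (simp add: window_contraction_def)

lemma stable_decay_nat:
  assumes x: "x \<in> stable_fibre \<theta>"
  shows "norm (\<Phi> (real j) \<theta> x) \<le> K ^ N * norm x / 2 ^ (j div N)"
proof -
  obtain B where B: "\<And>n. norm (\<Phi> (real n) \<theta> x) \<le> B" using x by (auto simp: stable_fibre_def)
  show ?thesis
  proof (rule half_line_decay[where a = "\<lambda>j. norm (\<Phi> (real j) \<theta> x)", OF N_ge_1 B])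
    show "0 \<le> K ^ N * norm x" using one_le_K_power[of N] by simp
    show "norm (\<Phi> (real j) \<theta> x) \<le> K ^ N * norm x" if "j < N" for j
      using that by (intro norm_cocycle_apply_le) auto
  next
    fix j c
    assume j: "N \<le> j" and c: "\<And>i. j - N \<le> i \<Longrightarrow> i \<le> j + N \<Longrightarrow> norm (\<Phi> (real i) \<theta> x) \<le> c"
    have eq: "\<Phi> (real k) (\<phi> (real (j - N)) \<theta>) (\<Phi> (real (j - N)) \<theta> x) = \<Phi> (real (k + (j - N))) \<theta> x" for k
      by (simp add: cocycle_add)
    have "norm (\<Phi> (real N) (\<phi> (real (j - N)) \<theta>) (\<Phi> (real (j - N)) \<theta> x)) \<le> c / 2"
      by (rule window_contractionD[OF window], unfold eq, rule c) (use j in auto)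
    then show "norm (\<Phi> (real j) \<theta> x) \<le> c / 2" unfolding eq using j by simp
  qed
qed

text \<open>The bound must involve \<open>y 0\<close> alone, although the window contraction compares with the maximum over
\<open>N\<close> consecutive points.  The orbit is therefore started \<open>N\<close> steps later: the sequence
\<open>a\<close> of the norms of \<open>\<Phi> N (y j)\<close> runs backward from \<open>\<Phi> N (y 0)\<close>, its first \<open>N\<close> terms
belong to the forward orbit of \<open>y 0\<close> and are bounded by \<open>K ^ N\<close> times its norm, and
\<open>a (j + N)\<close> is the norm of \<open>y j\<close>.\<close>

lemma backward_orbit_decay:
  assumes y: "backward_orbit \<theta> y"
  shows "norm (y j) \<le> K ^ N * norm (y 0) / 2 ^ (j div N)"
proof -
  define a where "a j = norm (\<Phi> (real N) (\<phi> (- real j) \<theta>) (y j))" for j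
  have a_eq: "\<Phi> (real N) (\<phi> (- real (i + j)) \<theta>) (y (i + j)) = \<Phi> (real (N - i)) (\<phi> (- real j) \<theta>) (y j)"
    if "i \<le> N" for i j
    using cocycle_add[of "real (N - i)" "real i" "\<phi> (- real (i + j)) \<theta>" "y (i + j)"]
      backward_orbit_step[OF y, of i j] that by (simp add: of_nat_diff)
  have a_add: "a (j + N) = norm (y j)" for j
    using a_eq[of N j] by (simp add: a_def add.commute)
  obtain B where B: "\<And>j. norm (y j) \<le> B" using y by (auto simp: backward_orbit_def)
  have D: "0 \<le> K ^ N * norm (y 0)" using one_le_K_power[of N] by simp
  have a_decay: "a j \<le> K ^ N * norm (y 0) / 2 ^ (j div N)" for j
  proof (rule half_line_decay[OF N_ge_1 _ D])
    show "a j \<le> K ^ N * B" for j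
      unfolding a_def by (rule norm_cocycle_apply_bound[OF _ _ B]) auto
    show "a j \<le> K ^ N * norm (y 0)" if "j < N" for j
      using a_eq[of j 0] that norm_cocycle_apply_le[of "real (N - j)" N \<theta> "y 0"] by (simp add: a_def)
  next
    fix j c
    assume j: "N \<le> j" and c: "\<And>i. j - N \<le> i \<Longrightarrow> i \<le> j + N \<Longrightarrow> a i \<le> c"
    have k: "norm (\<Phi> (real k) (\<phi> (- real j) \<theta>) (y j)) = a (j + N - k)" if "k \<le> 2 * N" for k
    proof (cases "k \<le> N")
      case True
      then show ?thesis using a_eq[of "N - k" j] by (simp add: a_def add.commute)
    next
      case False
      define i where "i = k - N"
      have i: "k = i + N" "i \<le> j" using False that j by (auto simp: i_def)
      have "\<Phi> (real k) (\<phi> (- real j) \<theta>) (y j)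
          = \<Phi> (real N) (\<phi> (- real (j - i)) \<theta>) (\<Phi> (real i) (\<phi> (- real j) \<theta>) (y j))"
        using cocycle_add[of "real N" "real i" "\<phi> (- real j) \<theta>" "y j"] i by (simp add: of_nat_diff algebra_simps)
      also have "\<Phi> (real i) (\<phi> (- real j) \<theta>) (y j) = y (j - i)"
        using backward_orbit_step[OF y, of i "j - i"] i by simp
      finally show ?thesis using i by (simp add: a_def)
    qed
    have "norm (\<Phi> (real N) (\<phi> (- real j) \<theta>) (y j)) \<le> c / 2"
      by (rule window_contractionD[OF window]) (use j in \<open>simp add: k c\<close>)
    then show "a j \<le> c / 2" by (simp add: a_def)
  qed
  have "norm (y j) \<le> K ^ N * norm (y 0) / 2 ^ ((j + N) div N)"
    using a_decay[of "j + N"] by (simp add: a_add)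
  also have "\<dots> \<le> K ^ N * norm (y 0) / 2 ^ (j div N)"
    using D N_ge_1 by (intro divide_left_mono power_increasing div_le_mono) auto
  finally show ?thesis .
qed


lemma exponent_le_ln_2: "ln 2 / real N \<le> ln 2"
  using N_ge_1 by (simp add: divide_le_eq)

lemma stable_decay:
  assumes t: "0 \<le> t" and x: "x \<in> stable_fibre \<theta>"
  shows "norm (\<Phi> t \<theta> x) \<le> 4 * K ^ (N + 1) * exp (- (ln 2 / real N) * t) * norm x"
proof -
  define \<epsilon> where "\<epsilon> = ln 2 / real N"
  define j where "j = nat \<lfloor>t\<rfloor>"
  have j: "0 \<le> t - real j" "t - real j \<le> 1" using t by (auto simp: j_def) linarith+
  have "\<epsilon> * (t - real j) \<le> ln 2"
    using mult_left_le[of "t - real j" \<epsilon>] exponent_le_ln_2 j by (simp add: \<epsilon>_def)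
  then have "exp (- \<epsilon> * real j) \<le> exp (ln 2 + - \<epsilon> * t)" by (simp add: algebra_simps)
  then have e: "exp (- \<epsilon> * real j) \<le> 2 * exp (- \<epsilon> * t)" unfolding exp_add by simp
  have "norm (\<Phi> t \<theta> x) = norm (\<Phi> (t - real j) (\<phi> (real j) \<theta>) (\<Phi> (real j) \<theta> x))"
    using j by (simp add: cocycle_add)
  also have "\<dots> \<le> K ^ 1 * (K ^ N * norm x / 2 ^ (j div N))"
    by (rule norm_cocycle_apply_bound[OF j(1) _ stable_decay_nat[OF x]]) (use j in simp)
  also have "\<dots> = K ^ (N + 1) * norm x * (1 / 2 ^ (j div N))" by simp
  also have "\<dots> \<le> K ^ (N + 1) * norm x * (2 * (2 * exp (- \<epsilon> * t)))"
    using halving_le_exp[OF N_ge_1, of j] e one_le_K_power[of "N + 1"]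
    by (intro mult_left_mono) (auto simp flip: \<epsilon>_def)
  finally show ?thesis by (simp add: \<epsilon>_def mult_ac)
qed

lemma unstable_growth:
  assumes t: "0 \<le> t" and x: "x \<in> unstable_fibre \<theta>"
  shows "norm x \<le> 4 * K ^ (N + 1) * exp (- (ln 2 / real N) * t) * norm (\<Phi> t \<theta> x)"
proof -
  define \<epsilon> where "\<epsilon> = ln 2 / real N"
  define j where "j = nat \<lceil>t\<rceil>"
  have j: "0 \<le> real j - t" "real j - t \<le> 1" using t by (auto simp: j_def) linarith+
  have "\<epsilon> * t \<le> \<epsilon> * real j" using j by (intro mult_left_mono) (auto simp: \<epsilon>_def)
  then have "exp (- \<epsilon> * real j) \<le> exp (- \<epsilon> * t)" by simp
  then have e: "exp (- \<epsilon> * real j) \<le> 2 * exp (- \<epsilon> * t)"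
    using exp_gt_zero[of "- \<epsilon> * t"] by linarith
  obtain y where y: "backward_orbit (\<phi> (real j) \<theta>) y" "y j = x" "y 0 = \<Phi> (real j) \<theta> x"
    by (rule unstable_extend[OF x])
  have "norm (\<Phi> (real j) \<theta> x) = norm (\<Phi> (real j - t) (\<phi> t \<theta>) (\<Phi> t \<theta> x))"
    using j t by (simp add: cocycle_add)
  also have "\<dots> \<le> K ^ 1 * norm (\<Phi> t \<theta> x)"
    by (rule norm_cocycle_apply_le) (use j in auto)
  finally have back_to_t: "norm (\<Phi> (real j) \<theta> x) \<le> K * norm (\<Phi> t \<theta> x)" by simp
  have "norm x \<le> K ^ N * norm (\<Phi> (real j) \<theta> x) * (1 / 2 ^ (j div N))"
    using backward_orbit_decay[OF y(1), of j] y by simp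
  also have "\<dots> \<le> K ^ N * (K * norm (\<Phi> t \<theta> x)) * (2 * (2 * exp (- \<epsilon> * t)))"
    using halving_le_exp[OF N_ge_1, of j] e back_to_t one_le_K_power[of N] K_ge_1
    by (intro mult_mono) (auto simp flip: \<epsilon>_def)
  finally show ?thesis by (simp add: \<epsilon>_def mult_ac)
qed

end

text \<open>At a time \<open>n\<close> with \<open>M exp (- \<epsilon> n) < 1 / 2\<close> the cocycle halves decaying vectors and doubles growing
ones, and its norm is at most \<open>K ^ n\<close>.  The constant \<open>C = K ^ n + 2\<close> is uniform over the base; this
is also why the projections of a dichotomy are uniformly bounded.\<close>

lemma uniform_transversality:
  assumes \<epsilon>: "0 < \<epsilon>" and M: "0 < M"
  shows "\<exists>C\<ge>0. \<forall>\<theta> s u.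
    (\<forall>t\<ge>0. norm (\<Phi> t \<theta> s) \<le> M * exp (- \<epsilon> * t) * norm s) \<longrightarrow>
    (\<forall>t\<ge>0. norm u \<le> M * exp (- \<epsilon> * t) * norm (\<Phi> t \<theta> u)) \<longrightarrow>
    norm s \<le> C * norm (s + u)"
proof -
  obtain n :: nat where n: "M * exp (- \<epsilon> * real n) < 1 / 2"
    using \<epsilon> by (rule exp_decay_small[where \<eta> = "1 / 2"]) simp
  show ?thesis
  proof (intro exI[of _ "K ^ n + 2"] conjI allI impI)
    show "0 \<le> K ^ n + 2" using one_le_K_power[of n] by simp
    fix \<theta> s u
    assume s: "\<forall>t\<ge>0. norm (\<Phi> t \<theta> s) \<le> M * exp (- \<epsilon> * t) * norm s"
      and u: "\<forall>t\<ge>0. norm u \<le> M * exp (- \<epsilon> * t) * norm (\<Phi> t \<theta> u)"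
    have "norm (\<Phi> (real n) \<theta> s) \<le> norm s / 2"
      using s[rule_format, of "real n"] mult_right_mono[OF less_imp_le[OF n], of "norm s"] by simp
    moreover have "2 * norm u \<le> norm (\<Phi> (real n) \<theta> u)"
      using u[rule_format, of "real n"]
        mult_right_mono[OF less_imp_le[OF n], of "norm (\<Phi> (real n) \<theta> u)"] by simp
    ultimately have "norm s \<le> (norm (\<Phi> (real n) \<theta>) + 2) * norm (s + u)"
      by (rule expanding_contracting_transversal)
    also have "\<dots> \<le> (K ^ n + 2) * norm (s + u)"
      by (intro mult_right_mono add_right_mono norm_cocycle_le) auto
    finally show "norm s \<le> (K ^ n + 2) * norm (s + u)" .
  qed
qed

section \<open>Existence of the splitting\<close>

text \<open>The errors of the single steps add up, each amplified by at most \<open>K ^ k\<close>.\<close>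

lemma pseudo_orbit_shadowing:
  assumes step: "\<And>j. norm (y (j + 1) - \<Phi> 1 (\<phi> (real_of_int j) \<theta>) (y j)) \<le> G"
  shows "norm (y (j + int k) - \<Phi> (real k) (\<phi> (real_of_int j) \<theta>) (y j)) \<le> real k * K ^ k * G"
proof (induction k)
  case 0
  then show ?case by simp
next
  case (Suc k)
  let ?m = "j + int k" and ?z = "\<Phi> (real k) (\<phi> (real_of_int j) \<theta>) (y j)"
  have G: "0 \<le> G" using step[of 0] norm_ge_zero order_trans by blast
  have "\<Phi> (real (Suc k)) (\<phi> (real_of_int j) \<theta>) (y j) = \<Phi> 1 (\<phi> (real_of_int ?m) \<theta>) ?z"
    using cocycle_add[of 1 "real k" "\<phi> (real_of_int j) \<theta>" "y j"] by (simp add: add.commute)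
  then have "norm (y (j + int (Suc k)) - \<Phi> (real (Suc k)) (\<phi> (real_of_int j) \<theta>) (y j))
      = norm ((y (?m + 1) - \<Phi> 1 (\<phi> (real_of_int ?m) \<theta>) (y ?m)) + \<Phi> 1 (\<phi> (real_of_int ?m) \<theta>) (y ?m - ?z))"
    by (simp add: blinfun.diff_right add_ac)
  also have "\<dots> \<le> G + K ^ 1 * (real k * K ^ k * G)"
    by (intro norm_triangle_mono step norm_cocycle_apply_bound Suc) auto
  also have "\<dots> \<le> real (Suc k) * K ^ Suc k * G"
    using mult_right_mono[OF one_le_K_power[of "Suc k"] G] by (simp add: algebra_simps)
  finally show ?case .
qed

lemma adjoint_cocycle_apply:
  "adjoint_cocycle \<phi> \<Phi> t \<theta> f = f o\<^sub>L \<Phi> t (\<phi> (- t) \<theta>)"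
  by (simp add: adjoint_cocycle_def blinfun_adjoint.rep_eq)

text \<open>Place the jump \<open>v\<close> at the base point and let \<open>y\<close> be a bounded solution of the recursion along the
orbit of \<open>\<theta>\<close>.  From time 0 on, \<open>y\<close> is a bounded forward orbit, and up to time -1 it is a bounded
backward orbit; the recursion at the jump writes \<open>v\<close> as the difference of \<open>y 0\<close> and the image of
\<open>y (- 1)\<close>.  The solution exists because the window contraction of \<open>\<Phi>\<close> survives small errors, and
because the window contraction of the adjoint cocycle leaves no nonzero bounded two-sided orbit.\<close>

lemma splitting_exists:
  assumes N: "window_contraction \<Phi> N" and N': "window_contraction (adjoint_cocycle \<phi> \<Phi>) N'"
  shows "\<exists>s\<in>stable_fibre \<theta>. \<exists>u\<in>unstable_fibre \<theta>. v = s + u"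
proof -
  define T where "T j = \<Phi> 1 (\<phi> (real_of_int j) \<theta>)" for j
  define E where "E = real (2 * N) * K ^ (2 * N)"
  have "1 \<le> N" using N by (simp add: window_contraction_def)
  then have "0 < E" using one_le_K_power[of "2 * N"] by (simp add: E_def)
  have "\<exists>y. (\<exists>B. \<forall>j. norm (y j) \<le> B) \<and> (\<forall>j. y (j + 1) - T j (y j) = (if j = - 1 then v else 0))"
  proof (rule bounded_solution_exists)
    show "norm (T j) \<le> K" for j unfolding T_def by (rule norm_le_K) auto
    show "0 < 3 * E" using \<open>0 < E\<close> by simp
    show "norm (y j) \<le> 3 * E * G"
      if bdd: "\<And>j. norm (y j) \<le> B" and err: "\<And>j. norm (y (j + 1) - T j (y j)) \<le> G" for y B G j
    proof (rule halving_bound[of "\<lambda>j. norm (y j)", OF bdd])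
      fix c j assume c: "\<And>i. norm (y i) \<le> c"
      \<comment> \<open>The window is centred at \<open>j\<close>; the orbit that starts at its left end \<open>b\<close> stays close to \<open>y\<close>.\<close>
      define b where "b = j - int N"
      have G: "0 \<le> G" using err[of 0] norm_ge_zero order_trans by blast
      have shadow: "norm (y (b + int k) - \<Phi> (real k) (\<phi> (real_of_int b) \<theta>) (y b)) \<le> E * G"
        if "k \<le> 2 * N" for k
      proof -
        have "norm (y (b + int k) - \<Phi> (real k) (\<phi> (real_of_int b) \<theta>) (y b)) \<le> real k * K ^ k * G"
          by (rule pseudo_orbit_shadowing) (use err in \<open>simp add: T_def\<close>)
        also have "\<dots> \<le> E * G"
          unfolding E_def using that K_ge_1 G by (intro mult_mono power_increasing) auto
        finally show ?thesis .
      qed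
      have "norm (\<Phi> (real N) (\<phi> (real_of_int b) \<theta>) (y b)) \<le> (c + E * G) / 2"
      proof (rule window_contractionD[OF N])
        fix k assume "k \<le> 2 * N"
        from norm_triangle_sub[of "\<Phi> (real k) (\<phi> (real_of_int b) \<theta>) (y b)" "y (b + int k)"]
          shadow[OF this] c[of "b + int k"]
        show "norm (\<Phi> (real k) (\<phi> (real_of_int b) \<theta>) (y b)) \<le> c + E * G"
          by (simp add: norm_minus_commute)
      qed
      with shadow[of N] norm_triangle_sub[of "y j" "\<Phi> (real N) (\<phi> (real_of_int b) \<theta>) (y b)"]
      have "norm (y j) \<le> (c + 3 * E * G) / 2" by (simp add: b_def)
      then show "norm (y j) \<le> 3 * E * G \<or> norm (y j) \<le> (c + 3 * E * G) / 2" ..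
    qed
    show "g j = 0" if bdd: "\<And>j. norm (g j) \<le> B" and orbit: "\<And>j. g j = g (j + 1) o\<^sub>L T (j + 1)"
      for g :: "int \<Rightarrow> ('b \<Rightarrow>\<^sub>L real)" and B j
    proof -
      have pullback: "adjoint_cocycle \<phi> \<Phi> (real k) (\<phi> (real_of_int j + 1) \<theta>) (g j) = g (j - int k)" for k j
      proof (induction k)
        case 0
        show ?case by (rule blinfun_eqI) (simp add: adjoint_cocycle_apply)
      next
        case (Suc k)
        have "g (j - int (Suc k)) = g (j - int k) o\<^sub>L \<Phi> 1 (\<phi> (real_of_int j - real k) \<theta>)"
          using orbit[of "j - int (Suc k)"] by (simp add: T_def)
        also have "\<dots> = g j o\<^sub>L (\<Phi> (real k) (\<phi> 1 (\<phi> (real_of_int j - real k) \<theta>)) o\<^sub>L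
            \<Phi> 1 (\<phi> (real_of_int j - real k) \<theta>))"
          unfolding Suc[symmetric]
          by (rule blinfun_eqI) (simp add: adjoint_cocycle_apply algebra_simps)
        also have "\<dots> = adjoint_cocycle \<phi> \<Phi> (real (Suc k)) (\<phi> (real_of_int j + 1) \<theta>) (g j)"
          unfolding cocycle_compose[OF of_nat_0_le_iff zero_le_one]
          by (simp add: adjoint_cocycle_apply algebra_simps)
        finally show ?case ..
      qed
      have "norm (g j) \<le> 0"
      proof (rule halving_bound[of "\<lambda>j. norm (g j)", OF bdd])
        fix c j assume c: "\<And>i. norm (g i) \<le> c"
        have "norm (adjoint_cocycle \<phi> \<Phi> (real N') (\<phi> (real_of_int (j + int N') + 1) \<theta>) (g (j + int N'))) \<le> c / 2"
          by (rule window_contractionD[OF N']) (simp only: pullback c)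
        then show "norm (g j) \<le> 0 \<or> norm (g j) \<le> (c + 0) / 2" unfolding pullback by simp
      qed
      then show ?thesis by simp
    qed
  qed
  then obtain y B where bdd: "\<And>j. norm (y j) \<le> B"
    and jump: "\<And>j. y (j + 1) - T j (y j) = (if j = - 1 then v else 0)"
    by blast
  have run: "\<Phi> (real k) (\<phi> (real_of_int m) \<theta>) (y m) = y (m + int k)"
    if "\<And>i. i < k \<Longrightarrow> m + int i \<noteq> - 1" for k m
    using that
  proof (induction k)
    case (Suc k)
    then have "\<Phi> (real k) (\<phi> (real_of_int m) \<theta>) (y m) = y (m + int k)" "m + int k \<noteq> - 1" by auto
    with jump[of "m + int k"] cocycle_add[of 1 "real k" "\<phi> (real_of_int m) \<theta>" "y m"]
    show ?case by (simp add: T_def algebra_simps)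
  qed simp
  have "y 0 \<in> stable_fibre \<theta>"
    using run[of _ 0] bdd by (auto simp: stable_fibre_def)
  moreover have "y (- 1) \<in> unstable_fibre (\<phi> (- 1) \<theta>)"
  proof -
    have "\<Phi> (real i) (\<phi> (- real (i + j)) (\<phi> (- 1) \<theta>)) (y (- 1 - int (i + j))) = y (- 1 - int j)" for i j
      using run[of i "- 1 - int (i + j)"] by (simp add: algebra_simps)
    then have "backward_orbit (\<phi> (- 1) \<theta>) (\<lambda>j. y (- 1 - int j))"
      using bdd by (auto simp: backward_orbit_def)
    then show ?thesis by (auto simp: unstable_fibre_def)
  qed
  then have "- \<Phi> 1 (\<phi> (- 1) \<theta>) (y (- 1)) \<in> unstable_fibre \<theta>"
    using unstable_invariant[of 1 "y (- 1)" "\<phi> (- 1) \<theta>"] subspace_neg[OF subspace_unstable] by simp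
  moreover have "v = y 0 + - \<Phi> 1 (\<phi> (- 1) \<theta>) (y (- 1))"
    using jump[of "- 1"] by (simp add: T_def)
  ultimately show ?thesis by blast
qed

section \<open>From window contraction to dichotomy\<close>

lemma continuous_cocycle_apply:
  assumes "0 \<le> t"
  shows "continuous_on UNIV (\<lambda>\<theta>. \<Phi> t (\<phi> s \<theta>) x)"
proof -
  have pair: "continuous_on UNIV (\<lambda>\<theta>. (s, \<theta>))" by (intro continuous_intros)
  have flow_cont: "continuous_on UNIV (\<lambda>(t, \<theta>). \<phi> t \<theta>)" using flow by (simp add: continuous_flow_def)
  have "continuous_on UNIV (\<lambda>\<theta>. \<phi> s \<theta>)"
    using continuous_on_compose2[OF flow_cont pair] by simp
  then have pair': "continuous_on UNIV (\<lambda>\<theta>. (t, \<phi> s \<theta>))" by (intro continuous_intros)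
  have "continuous_on ({0..} \<times> UNIV) (\<lambda>(t, \<theta>). \<Phi> t \<theta> x)"
    using cocycle by (simp add: exp_bounded_cocycle_def)
  from continuous_on_compose2[OF this pair'] show ?thesis using assms by auto
qed

lemma tendsto_cocycle_apply:
  "0 \<le> t \<Longrightarrow> ((\<lambda>\<eta>. \<Phi> t (\<phi> s \<eta>) x) \<longlongrightarrow> \<Phi> t (\<phi> s \<theta>) x) (at \<theta>)"
  using continuous_cocycle_apply[of t s x] by (auto simp: continuous_on_def)

text \<open>Continuity of the projections follows from the uniform estimates.  Let \<open>\<eta>\<close> be close to \<open>\<theta>\<close>.  A
vector \<open>s\<close> with \<open>P \<theta> s = s\<close> is strongly contracted over \<open>\<theta>\<close> up to a fixed time \<open>n\<close>, hence its orbit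
over \<open>\<eta>\<close> is bounded at time \<open>n\<close> too; its component in the kernel of \<open>P \<eta>\<close> grows exponentially up to
that time and must have been small.  A vector \<open>u\<close> in the kernel of \<open>P \<theta>\<close> is the image of some \<open>w\<close>
from time \<open>- n\<close>; the image \<open>u'\<close> of the same \<open>w\<close> over \<open>\<eta>\<close> is close to \<open>u\<close>, and its component
in the range of \<open>P \<eta>\<close> has been contracted for the time \<open>n\<close>.\<close>

lemma strongly_continuous_projection:
  fixes P :: "'a \<Rightarrow> ('b \<Rightarrow>\<^sub>L 'b)"
  assumes \<epsilon>: "0 < \<epsilon>" and M: "0 < M" and C: "0 \<le> C"
    and bound: "\<And>\<theta> x. norm (P \<theta> x) \<le> C * norm x"
    and idem: "\<And>\<theta> x. P \<theta> (P \<theta> x) = P \<theta> x"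
    and commute: "\<And>t \<theta> x. 0 \<le> t \<Longrightarrow> \<Phi> t \<theta> (P \<theta> x) = P (\<phi> t \<theta>) (\<Phi> t \<theta> x)"
    and decay: "\<And>t \<theta> x. 0 \<le> t \<Longrightarrow> norm (\<Phi> t \<theta> (P \<theta> x)) \<le> M * exp (- \<epsilon> * t) * norm (P \<theta> x)"
    and growth: "\<And>t \<theta> x. 0 \<le> t \<Longrightarrow> P \<theta> x = 0 \<Longrightarrow> norm x \<le> M * exp (- \<epsilon> * t) * norm (\<Phi> t \<theta> x)"
    and onto: "\<And>t \<theta> x. 0 \<le> t \<Longrightarrow> P \<theta> x = 0 \<Longrightarrow> \<exists>w. P (\<phi> (- t) \<theta>) w = 0 \<and> \<Phi> t (\<phi> (- t) \<theta>) w = x"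
  shows "continuous_on UNIV (\<lambda>\<theta>. P \<theta> x)"
proof -
  have contracting: "((\<lambda>\<eta>. P \<eta> s) \<longlongrightarrow> s) (at \<theta>)" if s: "P \<theta> s = s" for \<theta> s
  proof (rule tendstoI)
    fix e :: real assume "0 < e"
    define R where "R = M * norm s + 1"
    have "0 \<le> R" using M by (simp add: R_def)
    obtain n :: nat where n: "M * (1 + C) * R * exp (- \<epsilon> * real n) < e"
      using \<epsilon> \<open>0 < e\<close> by (rule exp_decay_small)
    have "norm (\<Phi> (real n) \<theta> s) \<le> M * exp (- \<epsilon> * real n) * norm s"
      using decay[of "real n" \<theta> s] by (simp add: s)
    also have "\<dots> \<le> M * 1 * norm s" using M \<epsilon> by (intro mult_right_mono mult_left_mono) auto
    finally have "norm (\<Phi> (real n) \<theta> s) < R" by (simp add: R_def)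
    moreover have "((\<lambda>\<eta>. norm (\<Phi> (real n) \<eta> s)) \<longlongrightarrow> norm (\<Phi> (real n) \<theta> s)) (at \<theta>)"
      using tendsto_norm[OF tendsto_cocycle_apply[of "real n" 0 s \<theta>]] by simp
    ultimately have "\<forall>\<^sub>F \<eta> in at \<theta>. norm (\<Phi> (real n) \<eta> s) < R" by (simp add: order_tendstoD)
    then show "\<forall>\<^sub>F \<eta> in at \<theta>. dist (P \<eta> s) s < e"
    proof eventually_elim
      case (elim \<eta>)
      define z where "z = \<Phi> (real n) \<eta> s"
      have "norm (s - P \<eta> s) \<le> M * exp (- \<epsilon> * real n) * norm (\<Phi> (real n) \<eta> (s - P \<eta> s))"
        by (rule growth) (simp_all add: blinfun.diff_right idem)
      also have "\<Phi> (real n) \<eta> (s - P \<eta> s) = z - P (\<phi> (real n) \<eta>) z"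
        by (simp add: blinfun.diff_right commute z_def)
      also have "norm \<dots> \<le> (1 + C) * norm z"
        using norm_triangle_ineq4[of z "P (\<phi> (real n) \<eta>) z"] bound[of "\<phi> (real n) \<eta>" z]
        by (simp add: distrib_right)
      also have "(1 + C) * norm z \<le> (1 + C) * R"
        using elim C by (intro mult_left_mono) (auto simp: z_def)
      also have "M * exp (- \<epsilon> * real n) * ((1 + C) * R) < e" using n by (simp add: mult_ac)
      finally show ?case using M by (simp add: dist_norm norm_minus_commute)
    qed
  qed
  have expanding: "((\<lambda>\<eta>. P \<eta> u) \<longlongrightarrow> 0) (at \<theta>)" if u: "P \<theta> u = 0" for \<theta> u
  proof (rule tendstoI)
    fix e :: real assume "0 < e"
    then have e: "0 < e / 2" by simp
    obtain n :: nat where n: "M * C * (M * norm u) * exp (- \<epsilon> * real n) < e / 2"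
      using \<epsilon> e by (rule exp_decay_small)
    obtain w where w: "P (\<phi> (- real n) \<theta>) w = 0" "\<Phi> (real n) (\<phi> (- real n) \<theta>) w = u"
      using onto[OF _ u, of "real n"] by auto
    have "norm w \<le> M * exp (- \<epsilon> * real n) * norm u"
      using growth[OF _ w(1), of "real n"] by (simp add: w)
    also have "\<dots> \<le> M * 1 * norm u" using M \<epsilon> by (intro mult_right_mono mult_left_mono) auto
    finally have w_le: "norm w \<le> M * norm u" by simp
    define u' where "u' \<eta> = \<Phi> (real n) (\<phi> (- real n) \<eta>) w" for \<eta>
    have "(u' \<longlongrightarrow> u) (at \<theta>)"
      using tendsto_cocycle_apply[of "real n" "- real n" w \<theta>] by (simp add: u'_def[abs_def] w)
    then have "((\<lambda>\<eta>. C * norm (u - u' \<eta>)) \<longlongrightarrow> C * norm (u - u)) (at \<theta>)"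
      by (intro tendsto_intros)
    then have "\<forall>\<^sub>F \<eta> in at \<theta>. C * norm (u - u' \<eta>) < e / 2"
      using e by (intro order_tendstoD) auto
    then show "\<forall>\<^sub>F \<eta> in at \<theta>. dist (P \<eta> u) 0 < e"
    proof eventually_elim
      case (elim \<eta>)
      let ?\<eta> = "\<phi> (- real n) \<eta>"
      have "norm (P \<eta> (u' \<eta>)) = norm (\<Phi> (real n) ?\<eta> (P ?\<eta> w))"
        using commute[of "real n" ?\<eta> w] by (simp add: u'_def)
      also have "\<dots> \<le> M * exp (- \<epsilon> * real n) * norm (P ?\<eta> w)" by (rule decay) simp
      also have "\<dots> \<le> M * exp (- \<epsilon> * real n) * (C * (M * norm u))"
        using M C w_le by (intro mult_left_mono order_trans[OF bound mult_left_mono]) auto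
      also have "\<dots> < e / 2" using n by (simp add: mult_ac)
      finally have "norm (P \<eta> (u' \<eta>)) < e / 2" .
      moreover have "norm (P \<eta> (u - u' \<eta>)) < e / 2" using bound elim by (rule le_less_trans)
      moreover have "P \<eta> u = P \<eta> (u - u' \<eta>) + P \<eta> (u' \<eta>)" by (simp add: blinfun.diff_right)
      ultimately show ?case
        using norm_triangle_ineq[of "P \<eta> (u - u' \<eta>)" "P \<eta> (u' \<eta>)"] by simp
    qed
  qed
  have "((\<lambda>\<eta>. P \<eta> x) \<longlongrightarrow> P \<theta> x) (at \<theta>)" for \<theta>
  proof -
    have "((\<lambda>\<eta>. P \<eta> (P \<theta> x) + P \<eta> (x - P \<theta> x)) \<longlongrightarrow> P \<theta> x + 0) (at \<theta>)"
      by (intro tendsto_add contracting expanding) (simp_all add: blinfun.diff_right idem)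
    then show ?thesis by (simp add: blinfun.diff_right)
  qed
  then show ?thesis by (simp add: continuous_on_def)
qed

lemma dichotomy_if_window_contraction:
  assumes N: "window_contraction \<Phi> N" and N': "window_contraction (adjoint_cocycle \<phi> \<Phi>) N'"
  shows "has_exponential_dichotomy \<phi> \<Phi>"
proof -
  define \<epsilon> where "\<epsilon> = ln 2 / real N"
  define M where "M = 4 * K ^ (N + 1)"
  have "1 \<le> N" using N by (simp add: window_contraction_def)
  then have \<epsilon>: "0 < \<epsilon>" by (simp add: \<epsilon>_def)
  have M: "0 < M" using one_le_K_power[of "N + 1"] by (simp add: M_def)
  have decay: "norm (\<Phi> t \<theta> x) \<le> M * exp (- \<epsilon> * t) * norm x" if "0 \<le> t" "x \<in> stable_fibre \<theta>" for t \<theta> x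
    using stable_decay[OF N that] by (simp add: M_def \<epsilon>_def)
  have growth: "norm x \<le> M * exp (- \<epsilon> * t) * norm (\<Phi> t \<theta> x)" if "0 \<le> t" "x \<in> unstable_fibre \<theta>" for t \<theta> x
    using unstable_growth[OF N that] by (simp add: M_def \<epsilon>_def)
  obtain C where C: "0 \<le> C"
    and angle: "\<And>\<theta> s u. \<forall>t\<ge>0. norm (\<Phi> t \<theta> s) \<le> M * exp (- \<epsilon> * t) * norm s \<Longrightarrow>
      \<forall>t\<ge>0. norm u \<le> M * exp (- \<epsilon> * t) * norm (\<Phi> t \<theta> u) \<Longrightarrow>
      norm s \<le> C * norm (s + u)"
    using uniform_transversality[OF \<epsilon> M] by blast
  have transversal: "norm s \<le> C * norm (s + u)" if "s \<in> stable_fibre \<theta>" "u \<in> unstable_fibre \<theta>" for \<theta> s u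
    by (rule angle[of \<theta>]) (use that decay growth in blast)+
  have "\<exists>P :: 'b \<Rightarrow>\<^sub>L 'b. (\<forall>s\<in>stable_fibre \<theta>. \<forall>u\<in>unstable_fibre \<theta>. blinfun_apply P (s + u) = s) \<and>
      range (blinfun_apply P) = stable_fibre \<theta> \<and> blinfun_ker P = unstable_fibre \<theta>" for \<theta>
    by (intro projection_of_splitting[where C = C] subspace_stable subspace_unstable splitting_exists[OF N N'] transversal)
  then obtain P :: "'a \<Rightarrow> ('b \<Rightarrow>\<^sub>L 'b)"
    where P_add: "\<And>\<theta> s u. s \<in> stable_fibre \<theta> \<Longrightarrow> u \<in> unstable_fibre \<theta> \<Longrightarrow> P \<theta> (s + u) = s"
      and range_P: "\<And>\<theta>. range (P \<theta>) = stable_fibre \<theta>" and ker_P: "\<And>\<theta>. blinfun_ker (P \<theta>) = unstable_fibre \<theta>"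
    by metis
  have P_stable: "P \<theta> x \<in> stable_fibre \<theta>" for \<theta> x using range_P by blast
  have P_zero_iff: "P \<theta> x = 0 \<longleftrightarrow> x \<in> unstable_fibre \<theta>" for \<theta> x
    using ker_P[of \<theta>] by (auto simp: blinfun_ker_def)
  have idem: "P \<theta> (P \<theta> x) = P \<theta> x" for \<theta> x
    using P_add[OF P_stable subspace_0[OF subspace_unstable]] by simp
  have compl: "x - P \<theta> x \<in> unstable_fibre \<theta>" for \<theta> x
    by (simp add: idem blinfun.diff_right flip: P_zero_iff)
  have commute: "\<Phi> t \<theta> (P \<theta> x) = P (\<phi> t \<theta>) (\<Phi> t \<theta> x)" if "0 \<le> t" for t \<theta> x
    using P_add[OF stable_invariant[OF that P_stable] unstable_invariant[OF that compl], of \<theta> x x]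
    by (simp add: blinfun.diff_right)
  have inj: "inj_on (\<Phi> t \<theta>) (unstable_fibre \<theta>)" if "0 \<le> t" for t \<theta>
  proof (rule inj_onI)
    fix x y assume xy: "x \<in> unstable_fibre \<theta>" "y \<in> unstable_fibre \<theta>" "\<Phi> t \<theta> x = \<Phi> t \<theta> y"
    have "norm (x - y) \<le> M * exp (- \<epsilon> * t) * norm (\<Phi> t \<theta> (x - y))"
      using that xy(1,2) by (intro growth subspace_diff[OF subspace_unstable])
    then show "x = y" using xy(3) by (simp add: blinfun.diff_right)
  qed
  have "continuous_on UNIV (\<lambda>\<theta>. P \<theta> x)" for x
  proof (rule strongly_continuous_projection[OF \<epsilon> M C _ idem commute])
    show "norm (P \<theta> x) \<le> C * norm x" for \<theta> x
      using transversal[OF P_stable compl, of \<theta> x x] by simp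
    show "\<exists>w. P (\<phi> (- t) \<theta>) w = 0 \<and> \<Phi> t (\<phi> (- t) \<theta>) w = x" if "0 \<le> t" "P \<theta> x = 0" for t \<theta> x
      using unstable_onto[of t x "\<phi> (- t) \<theta>"] that by (auto simp: P_zero_iff)
  qed (use decay growth P_stable P_zero_iff in auto)
  moreover have "bij_betw (\<Phi> t \<theta>) (unstable_fibre \<theta>) (unstable_fibre (\<phi> t \<theta>))" if "0 \<le> t" for t \<theta>
    unfolding bij_betw_def
    using inj[OF that] unstable_invariant[OF that] unstable_onto[OF that] by blast
  moreover have "inverse M * exp (\<epsilon> * t) * norm x \<le> norm (\<Phi> t \<theta> x)"
    if "0 \<le> t" "x \<in> unstable_fibre \<theta>" for t \<theta> x
    using growth[OF that] M by (simp add: field_simps exp_minus)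
  moreover have "P \<theta> o\<^sub>L P \<theta> = P \<theta>" for \<theta> by (rule blinfun_eqI) (simp add: idem)
  moreover have "\<Phi> t \<theta> o\<^sub>L P \<theta> = P (\<phi> t \<theta>) o\<^sub>L \<Phi> t \<theta>" if "0 \<le> t" for t \<theta>
    using that by (intro blinfun_eqI) (simp add: commute)
  ultimately show ?thesis
    unfolding has_exponential_dichotomy_def
    using \<epsilon> M decay
    by (intro exI[of _ P] exI[of _ \<epsilon>] exI[of _ M] conjI allI impI ballI) (simp_all only: range_P ker_P)
qed

section \<open>A dichotomy excludes Mane sequences\<close>

text \<open>The consequences of a dichotomy that the exclusion of Mane sequences uses, with the uniform bound
\<open>C\<close> on the projections and their complements supplied by transversality.\<close>

lemma dichotomyE:
  assumes "has_exponential_dichotomy \<phi> \<Phi>"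
  obtains P :: "'a \<Rightarrow> ('b \<Rightarrow>\<^sub>L 'b)" and C M \<epsilon> :: real
  where "0 < \<epsilon>" "0 < M" "0 \<le> C"
    "\<And>\<theta> x. norm (P \<theta> x) \<le> C * norm x" "\<And>\<theta> x. norm (x - P \<theta> x) \<le> C * norm x"
    "\<And>t \<theta> x. 0 \<le> t \<Longrightarrow> norm (\<Phi> t \<theta> (P \<theta> x)) \<le> M * exp (- \<epsilon> * t) * norm (P \<theta> x)"
    "\<And>t \<theta> x. 0 \<le> t \<Longrightarrow> P \<theta> x = 0 \<Longrightarrow> norm x \<le> M * exp (- \<epsilon> * t) * norm (\<Phi> t \<theta> x)"
    "\<And>\<theta> x. P \<theta> (x - P \<theta> x) = 0"
    "\<And>t \<theta> x. 0 \<le> t \<Longrightarrow> \<Phi> t \<theta> (P \<theta> x) = P (\<phi> t \<theta>) (\<Phi> t \<theta> x)"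
    "\<And>t \<theta> x. 0 \<le> t \<Longrightarrow> P \<theta> x = 0 \<Longrightarrow> \<exists>w. P (\<phi> (- t) \<theta>) w = 0 \<and> \<Phi> t (\<phi> (- t) \<theta>) w = x"
proof -
  obtain P :: "'a \<Rightarrow> ('b \<Rightarrow>\<^sub>L 'b)" and \<epsilon> M :: real where \<epsilon>: "0 < \<epsilon>" and M: "0 < M"
    and idem: "\<forall>\<theta>. P \<theta> o\<^sub>L P \<theta> = P \<theta>"
    and commute: "\<forall>t\<ge>0. \<forall>\<theta>. \<Phi> t \<theta> o\<^sub>L P \<theta> = P (\<phi> t \<theta>) o\<^sub>L \<Phi> t \<theta>"
    and decay: "\<forall>t\<ge>0. \<forall>\<theta>. \<forall>x\<in>range (blinfun_apply (P \<theta>)).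
      norm (\<Phi> t \<theta> x) \<le> M * exp (- \<epsilon> * t) * norm x"
    and kernel: "\<forall>t\<ge>0. \<forall>\<theta>.
      bij_betw (blinfun_apply (\<Phi> t \<theta>)) (blinfun_ker (P \<theta>)) (blinfun_ker (P (\<phi> t \<theta>))) \<and>
      (\<forall>x\<in>blinfun_ker (P \<theta>). norm (\<Phi> t \<theta> x) \<ge> inverse M * exp (\<epsilon> * t) * norm x)"
    using assms unfolding has_exponential_dichotomy_def by (elim exE conjE) (rule that)
  have idem': "P \<theta> (P \<theta> x) = P \<theta> x" for \<theta> x
    using idem by (metis blinfun_compose.rep_eq comp_apply)
  have ker: "P \<theta> (x - P \<theta> x) = 0" for \<theta> x by (simp add: blinfun.diff_right idem')
  have growth': "norm x \<le> M * exp (- \<epsilon> * t) * norm (\<Phi> t \<theta> x)" if "0 \<le> t" "P \<theta> x = 0" for t \<theta> x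
  proof -
    have "inverse M * exp (\<epsilon> * t) * norm x \<le> norm (\<Phi> t \<theta> x)"
      using kernel that by (simp add: blinfun_ker_def)
    then show ?thesis using M by (simp add: field_simps exp_minus)
  qed
  obtain C where C: "0 \<le> C" and transversal: "\<And>\<theta> s u. \<forall>t\<ge>0. norm (\<Phi> t \<theta> s) \<le> M * exp (- \<epsilon> * t) * norm s \<Longrightarrow>
      \<forall>t\<ge>0. norm u \<le> M * exp (- \<epsilon> * t) * norm (\<Phi> t \<theta> u) \<Longrightarrow>
      norm s \<le> C * norm (s + u)"
    using uniform_transversality[OF \<epsilon> M] by blast
  have P_le: "norm (P \<theta> x) \<le> C * norm x" for \<theta> x
    using transversal[of \<theta> "P \<theta> x" "x - P \<theta> x"] decay growth' ker by simp
  have le_1: "norm (P \<theta> x) \<le> (1 + C) * norm x" for \<theta> x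
    using P_le[of \<theta> x] norm_ge_zero[of x] unfolding distrib_right by linarith
  have le_2: "norm (x - P \<theta> x) \<le> (1 + C) * norm x" for \<theta> x
    using P_le[of \<theta> x] norm_triangle_ineq4[of x "P \<theta> x"] unfolding distrib_right by linarith
  have onto: "\<exists>w. P (\<phi> (- t) \<theta>) w = 0 \<and> \<Phi> t (\<phi> (- t) \<theta>) w = x" if "0 \<le> t" "P \<theta> x = 0" for t \<theta> x
  proof -
    have "bij_betw (\<Phi> t (\<phi> (- t) \<theta>)) (blinfun_ker (P (\<phi> (- t) \<theta>))) (blinfun_ker (P (\<phi> t (\<phi> (- t) \<theta>))))"
      using kernel that(1) by blast
    then have "x \<in> \<Phi> t (\<phi> (- t) \<theta>) ` blinfun_ker (P (\<phi> (- t) \<theta>))"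
      using that(2) by (simp add: bij_betw_def blinfun_ker_def)
    then show ?thesis by (auto simp: blinfun_ker_def)
  qed
  have commute': "\<Phi> t \<theta> (P \<theta> x) = P (\<phi> t \<theta>) (\<Phi> t \<theta> x)" if "0 \<le> t" for t \<theta> x
    using commute that by (metis blinfun_compose.rep_eq comp_apply)
  have decay': "norm (\<Phi> t \<theta> (P \<theta> x)) \<le> M * exp (- \<epsilon> * t) * norm (P \<theta> x)" if "0 \<le> t" for t \<theta> x
    using decay that by blast
  have "0 \<le> 1 + C" using C by simp
  from \<epsilon> M this le_1 le_2 decay' growth' ker commute' onto show thesis by (rule that)
qed

text \<open>The component of the initial vector in the range of \<open>P\<close> has decayed at time \<open>n\<close>, and the complementary
component at time \<open>n\<close> is small because it still has to grow up to time \<open>2 n\<close>, where it is bounded.\<close>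

lemma no_Mane_if_dichotomy:
  assumes dich: "has_exponential_dichotomy \<phi> \<Phi>"
  shows "\<not> Mane_sequence \<Phi> u"
proof
  obtain P :: "'a \<Rightarrow> ('b \<Rightarrow>\<^sub>L 'b)" and C M \<epsilon> :: real where \<epsilon>: "0 < \<epsilon>" and M: "0 < M" and C: "0 \<le> C"
    and P_le: "\<And>\<theta> x. norm (P \<theta> x) \<le> C * norm x"
    and compl_le: "\<And>\<theta> x. norm (x - P \<theta> x) \<le> C * norm x"
    and decay: "\<And>t \<theta> x. 0 \<le> t \<Longrightarrow> norm (\<Phi> t \<theta> (P \<theta> x)) \<le> M * exp (- \<epsilon> * t) * norm (P \<theta> x)"
    and growth: "\<And>t \<theta> x. 0 \<le> t \<Longrightarrow> P \<theta> x = 0 \<Longrightarrow> norm x \<le> M * exp (- \<epsilon> * t) * norm (\<Phi> t \<theta> x)"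
    and ker: "\<And>\<theta> x. P \<theta> (x - P \<theta> x) = 0"
    and commute: "\<And>t \<theta> x. 0 \<le> t \<Longrightarrow> \<Phi> t \<theta> (P \<theta> x) = P (\<phi> t \<theta>) (\<Phi> t \<theta> x)"
    by (rule dichotomyE[OF dich]) (rule that; assumption)
  assume "Mane_sequence \<Phi> u"
  then obtain c B where c: "0 < c" and mid: "\<And>n. 1 \<le> n \<Longrightarrow> c < norm (\<Phi> (real n) (fst (u n)) (snd (u n)))"
    and bdd: "\<And>n k. 1 \<le> n \<Longrightarrow> k \<le> 2 * n \<Longrightarrow> norm (\<Phi> (real k) (fst (u n)) (snd (u n))) < B"
    unfolding Mane_sequence_def by blast
  obtain n :: nat where n: "1 \<le> n" "2 * M * (C * B) * exp (- \<epsilon> * real n) < c"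
    using \<epsilon> c by (rule exp_decay_small)
  define \<theta> x where "\<theta> = fst (u n)" and "x = snd (u n)"
  define r where "r = M * exp (- \<epsilon> * real n)"
  have r: "0 \<le> r" using M by (simp add: r_def)
  have bdd': "norm (\<Phi> (real k) \<theta> x) \<le> B" if "k \<le> 2 * n" for k
    using bdd[OF n(1) that] by (simp add: \<theta>_def x_def)
  have "norm (\<Phi> (real n) \<theta> (P \<theta> x)) \<le> r * norm (P \<theta> x)" unfolding r_def by (rule decay) simp
  also have "\<dots> \<le> r * (C * B)"
    using bdd'[of 0] C by (intro mult_left_mono[OF _ r] order_trans[OF P_le mult_left_mono]) auto
  finally have s: "norm (\<Phi> (real n) \<theta> (P \<theta> x)) \<le> r * (C * B)" .
  let ?u = "\<Phi> (real n) \<theta> (x - P \<theta> x)"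
  have eq: "\<Phi> (real n) (\<phi> (real n) \<theta>) ?u = \<Phi> (real (2 * n)) \<theta> x - P (\<phi> (real (2 * n)) \<theta>) (\<Phi> (real (2 * n)) \<theta> x)"
    by (simp add: cocycle_add blinfun.diff_right commute)
  have "P (\<phi> (real n) \<theta>) ?u = 0"
    using commute[of "real n" \<theta> "x - P \<theta> x"] ker by simp
  then have "norm ?u \<le> r * norm (\<Phi> (real n) (\<phi> (real n) \<theta>) ?u)"
    unfolding r_def by (intro growth) simp
  also have "\<dots> \<le> r * (C * B)"
    unfolding eq
    using bdd'[of "2 * n"] C by (intro mult_left_mono[OF _ r] order_trans[OF compl_le mult_left_mono]) auto
  finally have u: "norm ?u \<le> r * (C * B)" .
  have "norm (\<Phi> (real n) \<theta> x) \<le> norm (\<Phi> (real n) \<theta> (P \<theta> x)) + norm ?u"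
    using norm_triangle_ineq[of "\<Phi> (real n) \<theta> (P \<theta> x)" ?u] by (simp add: blinfun.diff_right)
  also have "\<dots> \<le> 2 * r * (C * B)" using s u by simp
  also have "\<dots> < c" using n(2) by (simp add: r_def mult_ac)
  finally show False using mid[OF n(1)] by (simp add: \<theta>_def x_def)
qed

text \<open>The functional at time \<open>n\<close> is tested on both parts of a vector \<open>x\<close>.  On the range of \<open>P\<close> it is small
since \<open>\<Phi> n\<close> contracts and \<open>f\<close> is bounded; on the kernel, \<open>x - P x\<close> comes from a much smaller \<open>w\<close>
at \<open>n\<close> time units earlier, on which the functional at time \<open>2 n\<close> is bounded.\<close>

lemma no_adjoint_Mane_if_dichotomy:
  assumes dich: "has_exponential_dichotomy \<phi> \<Phi>"
  shows "\<not> Mane_sequence (adjoint_cocycle \<phi> \<Phi>) u"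
proof
  obtain P :: "'a \<Rightarrow> ('b \<Rightarrow>\<^sub>L 'b)" and C M \<epsilon> :: real where \<epsilon>: "0 < \<epsilon>" and M: "0 < M" and C: "0 \<le> C"
    and P_le: "\<And>\<theta> x. norm (P \<theta> x) \<le> C * norm x"
    and compl_le: "\<And>\<theta> x. norm (x - P \<theta> x) \<le> C * norm x"
    and decay: "\<And>t \<theta> x. 0 \<le> t \<Longrightarrow> norm (\<Phi> t \<theta> (P \<theta> x)) \<le> M * exp (- \<epsilon> * t) * norm (P \<theta> x)"
    and growth: "\<And>t \<theta> x. 0 \<le> t \<Longrightarrow> P \<theta> x = 0 \<Longrightarrow> norm x \<le> M * exp (- \<epsilon> * t) * norm (\<Phi> t \<theta> x)"
    and ker: "\<And>\<theta> x. P \<theta> (x - P \<theta> x) = 0"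
    and onto: "\<And>t \<theta> x. 0 \<le> t \<Longrightarrow> P \<theta> x = 0 \<Longrightarrow> \<exists>w. P (\<phi> (- t) \<theta>) w = 0 \<and> \<Phi> t (\<phi> (- t) \<theta>) w = x"
    by (rule dichotomyE[OF dich]) (rule that; assumption)
  let ?\<Psi> = "adjoint_cocycle \<phi> \<Phi>"
  assume "Mane_sequence ?\<Psi> u"
  then obtain c B where c: "0 < c" and mid: "\<And>n. 1 \<le> n \<Longrightarrow> c < norm (?\<Psi> (real n) (fst (u n)) (snd (u n)))"
    and bdd: "\<And>n k. 1 \<le> n \<Longrightarrow> k \<le> 2 * n \<Longrightarrow> norm (?\<Psi> (real k) (fst (u n)) (snd (u n))) < B"
    unfolding Mane_sequence_def by blast
  obtain n :: nat where n: "1 \<le> n" "2 * B * M * C * exp (- \<epsilon> * real n) < c"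
    using \<epsilon> c by (rule exp_decay_small)
  define \<theta> f where "\<theta> = fst (u n)" and "f = snd (u n)"
  define r where "r = M * exp (- \<epsilon> * real n)"
  have r: "0 \<le> r" using M by (simp add: r_def)
  have \<Psi>: "?\<Psi> t \<theta> f x = f (\<Phi> t (\<phi> (- t) \<theta>) x)" for t x by (simp add: adjoint_cocycle_apply)
  have bdd': "norm (?\<Psi> (real k) \<theta> f x) \<le> B * norm x" if "k \<le> 2 * n" for k x
    using bdd[OF n(1) that] norm_blinfun[of "?\<Psi> (real k) \<theta> f" x]
      mult_right_mono[OF less_imp_le[OF bdd[OF n(1) that]] norm_ge_zero[of x]]
    by (simp add: \<theta>_def f_def)
  have B: "0 \<le> B"
    by (rule order_trans[OF norm_ge_zero less_imp_le[OF bdd[OF n(1), of 0]]]) simp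
  let ?\<theta> = "\<phi> (- real n) \<theta>"
  have "norm (?\<Psi> (real n) \<theta> f x) \<le> 2 * B * r * C * norm x" for x
  proof -
    have "norm (?\<Psi> (real n) \<theta> f (P ?\<theta> x)) \<le> B * norm (\<Phi> (real n) ?\<theta> (P ?\<theta> x))"
      using bdd'[of 0 "\<Phi> (real n) ?\<theta> (P ?\<theta> x)"] by (simp add: \<Psi>)
    also have "\<dots> \<le> B * (r * (C * norm x))"
      unfolding r_def using M B
      by (intro mult_left_mono order_trans[OF decay mult_left_mono[OF P_le]]) auto
    finally have s: "norm (?\<Psi> (real n) \<theta> f (P ?\<theta> x)) \<le> B * (r * (C * norm x))" .
    obtain w where w: "P (\<phi> (- real n) ?\<theta>) w = 0" "\<Phi> (real n) (\<phi> (- real n) ?\<theta>) w = x - P ?\<theta> x"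
      using onto[OF _ ker, of "real n" ?\<theta> x] by auto
    have "?\<Psi> (real n) \<theta> f (x - P ?\<theta> x) = ?\<Psi> (real (2 * n)) \<theta> f w"
      using cocycle_add[of "real n" "real n" "\<phi> (- real n) ?\<theta>" w] by (simp add: \<Psi> flip: w(2))
    then have "norm (?\<Psi> (real n) \<theta> f (x - P ?\<theta> x)) \<le> B * norm w"
      using bdd'[of "2 * n" w] by simp
    also have "norm w \<le> r * norm (x - P ?\<theta> x)"
      unfolding r_def using growth[OF of_nat_0_le_iff w(1), of n, unfolded w(2)] .
    also have "\<dots> \<le> r * (C * norm x)" by (intro mult_left_mono compl_le r)
    finally have u: "norm (?\<Psi> (real n) \<theta> f (x - P ?\<theta> x)) \<le> B * (r * (C * norm x))"
      using B by (simp add: mult_left_mono)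
    have "norm (?\<Psi> (real n) \<theta> f x) \<le>
        norm (?\<Psi> (real n) \<theta> f (P ?\<theta> x)) + norm (?\<Psi> (real n) \<theta> f (x - P ?\<theta> x))"
      using norm_triangle_ineq[of "?\<Psi> (real n) \<theta> f (P ?\<theta> x)" "?\<Psi> (real n) \<theta> f (x - P ?\<theta> x)"]
      by (simp add: blinfun.diff_right)
    also have "\<dots> \<le> 2 * B * r * C * norm x" using s u by simp
    finally show ?thesis .
  qed
  then have "norm (?\<Psi> (real n) \<theta> f) \<le> 2 * B * r * C"
    using B r C by (intro norm_blinfun_bound) auto
  also have "\<dots> < c" using n(2) by (simp add: r_def mult_ac)
  finally show False using mid[OF n(1)] by (simp add: \<theta>_def f_def)
qed

end

theorem theorem2p3:
  fixes \<phi> :: "real \<Rightarrow> 'a::t2_space \<Rightarrow> 'a"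
    and \<Phi> :: "real \<Rightarrow> 'a \<Rightarrow> ('b::banach \<Rightarrow>\<^sub>L 'b)"
  assumes "locally compact (UNIV :: 'a set)"
    and "sigma_compact_space TYPE('a)"
    and "continuous_flow \<phi>"
    and "exp_bounded_cocycle \<phi> \<Phi>"
  shows "\<not> has_exponential_dichotomy \<phi> \<Phi> \<longleftrightarrow>
           (\<exists>u. Mane_sequence \<Phi> u) \<or> (\<exists>v. Mane_sequence (adjoint_cocycle \<phi> \<Phi>) v)"
proof -
  obtain K where K: "\<And>t \<theta>. 0 \<le> t \<Longrightarrow> t \<le> 1 \<Longrightarrow> norm (\<Phi> t \<theta>) \<le> K"
    using assms(4) by (force simp: exp_bounded_cocycle_def bdd_above_def)
  interpret flow_cocycle \<phi> \<Phi> "max 1 K"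
    by unfold_locales (use assms K in \<open>auto simp: le_max_iff_disj\<close>)
  have id: "\<Phi> 0 \<theta> = id_blinfun" for \<theta> by (rule blinfun_eqI) simp
  have id': "adjoint_cocycle \<phi> \<Phi> 0 \<theta> = id_blinfun" for \<theta>
    by (intro blinfun_eqI) (simp add: adjoint_cocycle_apply)
  have "has_exponential_dichotomy \<phi> \<Phi>"
    if "\<nexists>u. Mane_sequence \<Phi> u" "\<nexists>v. Mane_sequence (adjoint_cocycle \<phi> \<Phi>) v"
    using window_contraction_if_no_Mane[OF id that(1)] window_contraction_if_no_Mane[OF id' that(2)]
      dichotomy_if_window_contraction by blast
  with no_Mane_if_dichotomy no_adjoint_Mane_if_dichotomy show ?thesis by blast
qed

end
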